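(* For every integer $k\ge 1$, $$\begin{aligned}\zeta(4k-1)=\;&(2\pi)^{4k-1}\sum_{j=0}^k \frac{(-1)^{j+1}\, b_{jk}\, B_{2j}\, B_{4k-2j}}{(2j)!\,(4k-2j)!}+\frac{2^{4k+1}+4}{a_k}\,\mathcal{L}_{e^{-\sqrt{3}\pi}}(-4k+1)\\&-\frac{2^{4k+2}+2^{-4k+4}+12+8\cos\big[\frac{(2k-1)\pi}{3}\big]}{a_k}\,\mathcal{L}_{e^{-2\sqrt{3}\pi}}(-4k+1)\\&+\frac{2^{-4k+4}+8}{a_k}\,\mathcal{L}_{e^{-4\sqrt{3}\pi}}(-4k+1),\end{aligned}$$ where $$a_k=2^{4k}+4\sin\big[\tfrac{(4k+1)\pi}{6}\big],$$ $$b_{jk}=\frac{2^{4k+1-2j}\cos\big[\frac{(2j-1)\pi}{6}\big]+2^{2j+1}\cos\big[\frac{(4k-1-2j)\pi}{6}\big]}{a_k\,(1+\delta_{jk})}.$$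
   Context: For complex $q$ with $|q|<1$ and $s\in\mathbb{C}$, the Lambert series is $\mathcal{L}_q(s)=\sum_{n=1}^\infty \frac{n^s q^n}{1-q^n}$. $\zeta$ is the Riemann zeta function, $B_m$ is the $m$th Bernoulli number, and $\delta_{jk}$ is the Kronecker delta. *)

theory Defs
  imports "HOL-Complex_Analysis.Complex_Analysis"
begin

definition dirichlet_zeta :: "complex \<Rightarrow> complex" where
  "dirichlet_zeta s = (\<Sum>n. 1 / of_nat (Suc n) powr s)"

text \<open>
  The Riemann zeta function: the Dirichlet series for \<open>Re s > 1\<close>, and elsewhere its (unique)
  analytic continuation to the plane punctured at 1. The value at the pole is a dummy.
\<close>

definition zeta :: "complex \<Rightarrow> complex" where
  "zeta s = (if Re s > 1 then dirichlet_zeta s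
     else if s = 1 then 0
     else (SOME f. f holomorphic_on (- {1}) \<and> (\<forall>z. Re z > 1 \<longrightarrow> f z = dirichlet_zeta z)) s)"

text \<open>Bernoulli numbers, read off from the exponential generating function \<open>X / (exp X - 1)\<close>.\<close>

definition bernoulli :: "nat \<Rightarrow> real" where
  "bernoulli n = fact n * fps_nth (fps_X / (fps_exp 1 - 1)) n"

text \<open>The powers \<open>n\<^sup>s\<close> of positive integers are principal, i.e. \<open>exp (s * ln n)\<close> with real \<open>ln n\<close>.\<close>

definition lambert_series :: "complex \<Rightarrow> complex \<Rightarrow> complex" where
  "lambert_series q s =
     (\<Sum>n. of_nat (Suc n) powr s * q ^ Suc n / (1 - q ^ Suc n))"

definition coeff_a :: "nat \<Rightarrow> real" where
  "coeff_a k = 2 ^ (4 * k) + 4 * sin ((4 * real k + 1) * pi / 6)"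

definition coeff_b :: "nat \<Rightarrow> nat \<Rightarrow> real" where
  "coeff_b j k =
     (2 powi (4 * int k + 1 - 2 * int j) * cos ((2 * real j - 1) * pi / 6)
       + 2 ^ (2 * j + 1) * cos ((4 * real k - 1 - 2 * real j) * pi / 6))
     / (coeff_a k * (1 + (if j = k then 1 else 0)))"

end

theory Submission
  imports Defs
begin

text \<open>
  Write \<open>c = 4k - 1\<close> and \<open>F(\<tau>)\<close> for the Lambert series with exponent \<open>-c\<close> at \<open>q = exp (2\<pi>i\<tau>)\<close>.
  Up to the factor \<open>-i\<pi>\<close>, \<open>\<zeta>(c) + 2F(\<tau>)\<close> is the sum of \<open>\<pi> cot(\<pi>n\<tau>) / n\<^sup>c\<close>. Expanding the cotangents into
  partial fractions gives a double sum over \<open>n, m\<close>, which an elementary partial fraction identity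
  relates to the same sum at \<open>-1/\<tau>\<close>; the error terms are products of even zeta values. This is
  Ramanujan's formula. At \<open>\<tau> = 2 exp(i\<pi>/3)\<close>, where \<open>q = exp(-2\<surd>3\<pi>)\<close>, the point \<open>-1/\<tau>\<close> has
  \<open>q = -i exp(-\<surd>3\<pi>/2)\<close>. The real part of the formula involves the Lambert series only through their sum
  over \<open>q = \<plusminus>i exp(-\<surd>3\<pi>/2)\<close>, and the duplication formula for \<open>L(q) + L(-q)\<close>, used twice, reduces that sum to
  the three series of the theorem.
\<close>

section \<open>Partial fractions of the cotangent\<close>

lemma summable_on_inverse_power:
  assumes "k \<ge> 2"
  shows "(\<lambda>n. 1 / real n ^ k) summable_on {1..}"
proof -
  have "summable (\<lambda>n. 1 / real n ^ k)"
    using inverse_power_summable[OF assms, where 'a = real] by (simp add: inverse_eq_divide)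
  then have "(\<lambda>n. 1 / real n ^ k) summable_on UNIV"
    by (intro summable_nonneg_imp_summable_on) auto
  then show ?thesis
    by (rule summable_on_subset_banach) auto
qed

lemma summable_on_complex_bound:
  fixes f :: "'a \<Rightarrow> complex"
  assumes "g summable_on A" "\<And>x. x \<in> A \<Longrightarrow> norm (f x) \<le> g x"
  shows "f summable_on A"
  by (rule Infinite_Sum.abs_summable_summable, rule Infinite_Sum.abs_summable_on_comparison_test'[OF assms])

lemma summable_on_times_nonneg:
  fixes f :: "'a \<Rightarrow> real" and g :: "'b \<Rightarrow> real"
  assumes "f summable_on A" "g summable_on B" "\<And>x. x \<in> A \<Longrightarrow> f x \<ge> 0" "\<And>y. y \<in> B \<Longrightarrow> g y \<ge> 0"
  shows "(\<lambda>(x, y). f x * g y) summable_on A \<times> B"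
proof (rule summable_on_SigmaI[where g = "\<lambda>x. f x * infsum g B"])
  show "((\<lambda>y. case (x, y) of (x, y) \<Rightarrow> f x * g y) has_sum f x * infsum g B) B" for x
    using assms(2) by (auto intro!: has_sum_cmult_right)
  show "(\<lambda>x. f x * infsum g B) summable_on A"
    using assms(1) by (rule summable_on_cmult_left)
qed (use assms in auto)

lemma has_sum_imp_sums_Suc:
  fixes f :: "nat \<Rightarrow> 'a :: real_normed_vector"
  assumes "(f has_sum S) {1..}"
  shows "(\<lambda>n. f (Suc n)) sums S"
proof -
  have "(f has_sum S) {1..} \<longleftrightarrow> ((\<lambda>n. f (Suc n)) has_sum S) UNIV"
    by (rule has_sum_reindex_bij_witness[of _ Suc "\<lambda>n. n - 1"]) auto
  with assms show ?thesis
    using has_sum_imp_sums by blast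
qed

text \<open>Logarithmic differentiation of the reflection formula for the Gamma function. It is
  carried out on \<open>rGamma\<close>, which is entire, so that no poles intervene; dividing by the
  nonzero product \<open>rGamma z * rGamma (1 - z)\<close> comes last.\<close>

lemma Digamma_reflection:
  fixes z :: complex
  assumes "z \<notin> \<int>"
  shows "Digamma (1 - z) - Digamma z = of_real pi * cot (of_real pi * z)"
proof -
  have z: "z \<notin> \<int>\<^sub>\<le>\<^sub>0" "1 - z \<notin> \<int>\<^sub>\<le>\<^sub>0"
    using assms by (auto dest: nonpos_Ints_Int)
  have "((\<lambda>z. rGamma z * rGamma (1 - z)) has_field_derivative
      (- rGamma z * Digamma z) * rGamma (1 - z) + rGamma z * (- rGamma (1 - z) * Digamma (1 - z) * (-1))) (at z)"
    using z by (auto intro!: derivative_eq_intros)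
  moreover have "((\<lambda>z. sin (of_real pi * z) / of_real pi) has_field_derivative cos (of_real pi * z)) (at z)"
    by (auto intro!: derivative_eq_intros)
  ultimately have "(- rGamma z * Digamma z) * rGamma (1 - z) + rGamma z * (- rGamma (1 - z) * Digamma (1 - z) * (-1))
      = cos (of_real pi * z)"
    unfolding rGamma_reflection_complex by (rule DERIV_unique)
  then have "rGamma z * rGamma (1 - z) * (Digamma (1 - z) - Digamma z) = cos (of_real pi * z)"
    by (simp add: algebra_simps)
  then have *: "sin (of_real pi * z) * (Digamma (1 - z) - Digamma z) = of_real pi * cos (of_real pi * z)"
    by (simp add: rGamma_reflection_complex field_simps)
  have "rGamma z \<noteq> 0" "rGamma (1 - z) \<noteq> 0"
    using z by (simp_all add: rGamma_eq_zero_iff)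
  then have "sin (of_real pi * z) \<noteq> 0"
    using rGamma_reflection_complex[of z] by auto
  with * show ?thesis
    by (simp add: cot_def field_simps)
qed

lemma summable_on_cot_terms:
  fixes z :: complex
  shows "(\<lambda>m. 2 * z / (z\<^sup>2 - of_nat m ^ 2)) summable_on {1..}"
proof -
  \<comment> \<open>From \<open>N\<close> on, \<open>m\<close> is at least twice
    \<open>norm z\<close>, so the denominator has norm at least half of \<open>m ^ 2\<close>. The
    finitely many earlier terms are added back at the end.\<close>
  define N where "N = nat \<lceil>2 * norm z\<rceil> + 1"
  have "(\<lambda>m. 2 * z / (z\<^sup>2 - of_nat m ^ 2)) summable_on {N..}"
  proof (rule summable_on_complex_bound)
    show "(\<lambda>m. 4 * norm z * (1 / real m ^ 2)) summable_on {N..}"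
      by (intro summable_on_cmult_right summable_on_subset_banach[OF summable_on_inverse_power])
         (auto simp: N_def)
  next
    fix m assume "m \<in> {N..}"
    then have m: "m \<ge> 1" "real m \<ge> 2 * norm z"
      unfolding N_def by auto linarith
    have "(2 * norm z)^2 \<le> real m ^ 2"
      using m by (intro power_mono) auto
    moreover have "norm (of_nat m ^ 2 :: complex) - norm (z\<^sup>2) \<le> norm (z\<^sup>2 - of_nat m ^ 2)"
      by (metis norm_minus_commute norm_triangle_ineq2)
    ultimately have "norm (z\<^sup>2 - of_nat m ^ 2) \<ge> real m ^ 2 / 2"
      unfolding norm_power norm_of_nat power_mult_distrib by (simp add: zero_le_power2 add_increasing2 pos_divide_le_eq) (use zero_le_power2[of "norm z"] in linarith)
    then have "2 * norm z / norm (z\<^sup>2 - of_nat m ^ 2) \<le> 2 * norm z / (real m ^ 2 / 2)"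
      using m by (intro divide_left_mono mult_pos_pos) (auto intro: less_le_trans[rotated])
    then show "norm (2 * z / (z\<^sup>2 - of_nat m ^ 2)) \<le> 4 * norm z * (1 / real m ^ 2)"
      by (simp add: norm_divide norm_mult)
  qed
  then have "(\<lambda>m. 2 * z / (z\<^sup>2 - of_nat m ^ 2)) summable_on {1..<N} \<union> {N..}"
    by (intro summable_on_union) auto
  also have "{1..<N} \<union> {N..} = {1..}"
    by (auto simp: N_def)
  finally show ?thesis .
qed

text \<open>The series of \<open>Digamma (1 - z)\<close> and \<open>Digamma (1 + z)\<close> differ
  termwise by the summand. The reflection formula evaluates the difference, and the recurrence from
  \<open>z\<close> to \<open>1 + z\<close> produces the \<open>1 / z\<close>.\<close>

lemma cot_partial_fractions:
  fixes z :: complex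
  assumes "z \<notin> \<int>"
  shows "((\<lambda>m. 2 * z / (z\<^sup>2 - of_nat m ^ 2)) has_sum (of_real pi * cot (of_real pi * z) - 1 / z)) {1..}"
proof -
  let ?f = "\<lambda>m. 2 * z / (z\<^sup>2 - of_nat m ^ 2)"
  have nz: "z \<noteq> 0" "1 - z \<noteq> 0" "1 + z \<noteq> 0"
    using assms Ints_0 Ints_1 by (auto simp: add_eq_0_iff) 
  have nz': "z - of_nat n \<noteq> 0" "z + of_nat n \<noteq> 0" for n
    using assms by auto (metis Ints_of_nat add_eq_0_iff minus_in_Ints_iff)
  have "(\<lambda>n. (inverse (of_nat (Suc n)) - inverse (1 - z + of_nat n)) -
             (inverse (of_nat (Suc n)) - inverse (1 + z + of_nat n))) sums
          ((Digamma (1 - z) + euler_mascheroni) - (Digamma (1 + z) + euler_mascheroni))"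
    unfolding Digamma_def diff_add_cancel
    by (intro sums_diff summable_sums summable_Digamma nz)
  also have "(\<lambda>n. (inverse (of_nat (Suc n)) - inverse (1 - z + of_nat n)) -
             (inverse (of_nat (Suc n)) - inverse (1 + z + of_nat n))) = (\<lambda>n. ?f (Suc n))"
  proof
    fix n
    have *: "1 - z + of_nat n = of_nat (Suc n) - z" "1 + z + of_nat n = z + of_nat (Suc n)"
      by simp_all
    have "inverse (z + w) - inverse (w - z) = 2 * z / (z\<^sup>2 - w\<^sup>2)" if "z - w \<noteq> 0" "z + w \<noteq> 0" for w
    proof -
      have w: "w - z \<noteq> 0" "z\<^sup>2 - w\<^sup>2 = - ((w - z) * (z + w))"
        using that by (auto simp: algebra_simps power2_eq_square)
      show ?thesis
        unfolding w(2) using w(1) that by (simp add: divide_simps)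
    qed
    from this[of "of_nat (Suc n)"] show "(inverse (of_nat (Suc n)) - inverse (1 - z + of_nat n)) -
             (inverse (of_nat (Suc n)) - inverse (1 + z + of_nat n)) = ?f (Suc n)"
      unfolding * using nz'[of "Suc n"] by simp
  qed
  also have "(Digamma (1 - z) + euler_mascheroni) - (Digamma (1 + z) + euler_mascheroni) =
      of_real pi * cot (of_real pi * z) - 1 / z"
    using Digamma_reflection[OF assms] Digamma_plus1[of z] nz by (simp add: add.commute)
  finally have sums: "(\<lambda>n. ?f (Suc n)) sums (of_real pi * cot (of_real pi * z) - 1 / z)" .
  \<comment> \<open>The Digamma series yields only an ordered sum. Absolute convergence gives an
    unordered one, and the two must agree.\<close>
  have "(\<lambda>n. ?f (Suc n)) sums infsum ?f {1..}"
    using summable_on_cot_terms by (intro has_sum_imp_sums_Suc has_sum_infsum)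
  with sums have "infsum ?f {1..} = of_real pi * cot (of_real pi * z) - 1 / z"
    using sums_unique2 by blast
  then show ?thesis
    using summable_on_cot_terms[of z] by (simp add: has_sum_iff)
qed

section \<open>Zeta at the even integers\<close>

text \<open>An unordered sum, so that double series can be rearranged freely. The value at 0 is not
  that of the continued zeta function; wherever -1/2 is wanted there, it is supplied
  separately.\<close>

definition zeta_nat :: "nat \<Rightarrow> complex" where
  "zeta_nat k = (\<Sum>\<^sub>\<infinity>n\<in>{1..}. 1 / of_nat n ^ k)"

lemma summable_on_zeta_nat:
  assumes "k \<ge> 2"
  shows "(\<lambda>n. 1 / of_nat n ^ k :: complex) summable_on {1..}"
  by (rule summable_on_complex_bound[OF summable_on_inverse_power[OF assms]])
     (simp add: norm_divide norm_power)

lemma has_sum_zeta_nat: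
  assumes "k \<ge> 2"
  shows "((\<lambda>n. 1 / of_nat n ^ k) has_sum zeta_nat k) {1..}"
  using summable_on_zeta_nat[OF assms] by (simp add: zeta_nat_def)

lemma not_Int_if_norm_less_1:
  fixes z :: complex
  assumes "z \<noteq> 0" "norm z < 1"
  shows "z \<notin> \<int>"
  using assms by (auto elim!: Ints_cases)

text \<open>The double series of \<open>(z\<^sup>2 / m\<^sup>2) ^ i\<close> is summed in both
  orders. Summing over \<open>i\<close> first gives geometric series, which are the partial
  fractions of the cotangent up to the factor \<open>- z / 2\<close>; summing over \<open>m\<close>
  first gives the zeta values.\<close>

lemma has_sum_cot_power_series:
  assumes "z \<noteq> 0" "norm z < 1"
  shows "((\<lambda>i. zeta_nat (2 * i) * z ^ (2 * i)) has_sum (1 - of_real pi * z * cot (of_real pi * z)) / 2) {1..}"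
proof -
  define f where "f = (\<lambda>(m :: nat, i :: nat). (z\<^sup>2 / of_nat m ^ 2) ^ i)"
  define S where "S = infsum f ({1..} \<times> {1..})"
  \<comment> \<open>A majorant in product form: as \<open>i\<close> is at least 1, the denominator
    \<open>m ^ (2 * i)\<close> may be replaced by \<open>m ^ 2\<close>.\<close>
  have "(\<lambda>(m, i). (1 / real m ^ 2) * (norm z ^ 2) ^ i) summable_on {1..} \<times> {1..}"
  proof (rule summable_on_times_nonneg)
    have "norm (norm z ^ 2) < 1"
      using assms by (simp add: abs_square_less_1)
    then show "(\<lambda>i. (norm z ^ 2) ^ i) summable_on {1..}"
      using has_sum_geometric_from_1 has_sum_imp_summable by blast
  qed (use summable_on_inverse_power[of 2] in auto)
  then have "f summable_on {1..} \<times> {1..}"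
  proof (rule summable_on_complex_bound)
    fix x :: "nat \<times> nat" assume "x \<in> {1..} \<times> {1..}"
    then obtain m i where mi: "x = (m, i)" "m \<ge> 1" "i \<ge> 1"
      by auto
    then have "real m ^ 2 \<le> (real m ^ 2) ^ i"
      by (intro self_le_power) auto
    then have "(norm z ^ 2) ^ i / (real m ^ 2) ^ i \<le> (norm z ^ 2) ^ i / real m ^ 2"
      using mi by (intro divide_left_mono mult_pos_pos) auto
    then show "norm (f x) \<le> (case x of (m, i) \<Rightarrow> (1 / real m ^ 2) * (norm z ^ 2) ^ i)"
      by (simp add: mi f_def norm_power norm_divide power_divide)
  qed
  then have S: "(f has_sum S) ({1..} \<times> {1..})"
    by (simp add: S_def)
  have "((\<lambda>m. - z / 2 * (2 * z / (z\<^sup>2 - of_nat m ^ 2))) has_sum S) {1..}"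
  proof (rule has_sum_SigmaD[OF S])
    fix m :: nat assume m: "m \<in> {1..}"
    have "norm z < real m"
      using m assms by auto
    then have zm: "norm z ^ 2 < real m ^ 2"
      by (intro power_strict_mono) auto
    then have "norm (z\<^sup>2 / of_nat m ^ 2) < 1"
      using m by (simp add: norm_divide norm_power)
    then have "((\<lambda>i. f (m, i)) has_sum (z\<^sup>2 / of_nat m ^ 2 / (1 - z\<^sup>2 / of_nat m ^ 2))) {1..}"
      unfolding f_def prod.case by (rule has_sum_geometric_from_1)
    moreover have "z\<^sup>2 \<noteq> of_nat m ^ 2"
      using zm by (metis norm_of_nat norm_power less_irrefl)
    then have "z\<^sup>2 / of_nat m ^ 2 / (1 - z\<^sup>2 / of_nat m ^ 2) = - z / 2 * (2 * z / (z\<^sup>2 - of_nat m ^ 2))"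
      using m by (simp add: divide_simps) (simp add: algebra_simps power2_eq_square)
    ultimately show "((\<lambda>i. f (m, i)) has_sum (- z / 2 * (2 * z / (z\<^sup>2 - of_nat m ^ 2)))) {1..}"
      by simp
  qed
  moreover have "((\<lambda>m. - z / 2 * (2 * z / (z\<^sup>2 - of_nat m ^ 2))) has_sum
      (- z / 2 * (of_real pi * cot (of_real pi * z) - 1 / z))) {1..}"
    by (intro has_sum_cmult_right cot_partial_fractions not_Int_if_norm_less_1 assms)
  ultimately have "S = - z / 2 * (of_real pi * cot (of_real pi * z) - 1 / z)"
    by (rule has_sum_unique)
  also have "\<dots> = (1 - of_real pi * z * cot (of_real pi * z)) / 2"
    using assms by (simp add: field_simps)
  finally have S_eq: "S = (1 - of_real pi * z * cot (of_real pi * z)) / 2" .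
  have "((\<lambda>(i, m). f (m, i)) has_sum S) ({1..} \<times> {1..})"
    using S by (subst (asm) has_sum_swap)
  then have "((\<lambda>i. zeta_nat (2 * i) * z ^ (2 * i)) has_sum S) {1..}"
  proof (rule has_sum_SigmaD)
    fix i :: nat assume i: "i \<in> {1..}"
    have "((\<lambda>m. 1 / of_nat m ^ (2 * i) * z ^ (2 * i)) has_sum zeta_nat (2 * i) * z ^ (2 * i)) {1..}"
      using i by (intro has_sum_cmult_left has_sum_zeta_nat) auto
    then show "((\<lambda>m. (case (i, m) of (i, m) \<Rightarrow> f (m, i))) has_sum zeta_nat (2 * i) * z ^ (2 * i)) {1..}"
      by (simp add: f_def power_divide power_mult)
  qed
  then show ?thesis
    unfolding S_eq .
qed

section \<open>The Taylor series of pi z cot(pi z) and Bernoulli numbers\<close>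

lemma cot_pi_exp:
  fixes z :: complex
  assumes "exp (2 * of_real pi * \<i> * z) \<noteq> 1"
  shows "cot (of_real pi * z) =
    \<i> * (exp (2 * of_real pi * \<i> * z) + 1) / (exp (2 * of_real pi * \<i> * z) - 1)"
proof -
  define e where "e = exp (\<i> * (of_real pi * z))"
  have e: "e \<noteq> 0" "exp (2 * of_real pi * \<i> * z) = e\<^sup>2"
    by (auto simp: e_def exp_double[symmetric] mult_ac)
  have s: "sin (of_real pi * z) = (e\<^sup>2 - 1) / (2 * \<i> * e)"
    and c: "cos (of_real pi * z) = (e\<^sup>2 + 1) / (2 * e)"
    using e(1) unfolding sin_exp_eq cos_exp_eq exp_minus e_def[symmetric]
    by (simp_all add: field_simps power2_eq_square)
  show ?thesis
    using e assms by (simp add: cot_def s c)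
qed

text \<open>The Taylor series of pi z cot(pi z) at 0. Its constant term 1 fits the pattern of the
  others, being -2 times the true zeta(0) = -1/2.\<close>

definition cot_fps :: "complex fps" where
  "cot_fps = Abs_fps (\<lambda>n. if n = 0 then 1 else if even n then - 2 * zeta_nat n else 0)"

lemma cot_fps_sums:
  assumes "norm z < 1"
  shows "(\<lambda>n. fps_nth cot_fps n * z ^ n) sums (if z = 0 then 1 else of_real pi * z * cot (of_real pi * z))"
proof (cases "z = 0")
  case True
  then show ?thesis
    using powser_sums_zero[of "fps_nth cot_fps"] by (simp add: cot_fps_def)
next
  case False
  let ?g = "\<lambda>n. fps_nth cot_fps n * z ^ n"
  define c where "c = of_real pi * z * cot (of_real pi * z)"
  have "((\<lambda>i. - 2 * (zeta_nat (2 * i) * z ^ (2 * i))) has_sum (- 2 * ((1 - c) / 2))) {1..}"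
    unfolding c_def by (intro has_sum_cmult_right has_sum_cot_power_series False assms)
  also have "?this \<longleftrightarrow> (?g has_sum (c - 1)) {n. even n \<and> n \<noteq> 0}"
    by (rule has_sum_reindex_bij_witness[of _ "\<lambda>n. n div 2" "\<lambda>i. 2 * i"])
       (auto simp: cot_fps_def field_simps elim!: evenE)
  also have "\<dots> \<longleftrightarrow> (?g has_sum (c - 1)) (UNIV - {0})"
    by (rule has_sum_cong_neutral) (auto simp: cot_fps_def)
  finally have "(?g has_sum (?g 0 + (c - 1))) (insert 0 (UNIV - {0}))"
    by (intro has_sum_insert) auto
  also have "insert 0 (UNIV - {0 :: nat}) = UNIV"
    by auto
  also have "?g 0 + (c - 1) = c"
    by (simp add: cot_fps_def)
  finally show ?thesis
    using False by (simp add: has_sum_imp_sums c_def)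
qed

text \<open>The exponential form of the cotangent with denominators cleared. Both sides expand the
  same function near 0, and expansions are unique.\<close>

lemma cot_fps_equation:
  "cot_fps * (fps_exp (2 * of_real pi * \<i>) - 1) =
     fps_const (\<i> * of_real pi) * fps_X * (fps_exp (2 * of_real pi * \<i>) + 1)"
proof -
  let ?f = "\<lambda>z. if z = 0 then 1 else of_real pi * z * cot (of_real pi * z)"
  let ?c = "2 * of_real pi * \<i>"
  have "eventually (\<lambda>z :: complex. z \<in> ball 0 1) (nhds 0)"
    by (intro eventually_nhds_in_open) auto
  then have ev: "eventually (\<lambda>z :: complex. norm z < 1) (nhds 0)"
    by simp
  then have "?f has_fps_expansion cot_fps"
    by (intro has_fps_expansionI, eventually_elim) (rule cot_fps_sums)
  then have "(\<lambda>z. ?f z * (exp (?c * z) - 1)) has_fps_expansion cot_fps * (fps_exp ?c - 1)"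
    by (intro fps_expansion_intros)
  also have "?this \<longleftrightarrow> (\<lambda>z. \<i> * of_real pi * z * (exp (?c * z) + 1)) has_fps_expansion cot_fps * (fps_exp ?c - 1)"
  proof (intro has_fps_expansion_cong refl, use ev in eventually_elim)
    fix z :: complex assume z: "norm z < 1"
    show "?f z * (exp (?c * z) - 1) = \<i> * of_real pi * z * (exp (?c * z) + 1)"
    proof (cases "z = 0")
      case False
      \<comment> \<open>The exponential equals 1 only at integers, and 0 is the only integer in the
        unit disc.\<close>
      have "exp (?c * z) \<noteq> 1"
      proof
        assume "exp (?c * z) = 1"
        then obtain k :: int where "Re z = of_int k" "Im z = 0"
          by (auto simp: exp_eq_1)
        then have "z = of_int k"
          by (simp add: complex_eq_iff)
        with not_Int_if_norm_less_1[OF False z] show False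
          by simp
      qed
      then show ?thesis
        using False by (simp add: cot_pi_exp divide_simps)
    qed auto
  qed
  finally have "(\<lambda>z. \<i> * of_real pi * z * (exp (?c * z) + 1)) has_fps_expansion cot_fps * (fps_exp ?c - 1)" .
  moreover have "(\<lambda>z. \<i> * of_real pi * z * (exp (?c * z) + 1)) has_fps_expansion
      fps_const (\<i> * of_real pi) * fps_X * (fps_exp ?c + 1)"
    by (intro fps_expansion_intros)
  ultimately show ?thesis
    by (rule fps_expansion_unique_complex)
qed

text \<open>The defining quotient with X scaled by \<open>c\<close> and its denominator cleared. In
  each coefficient of the product the powers of \<open>c\<close> combine to \<open>c ^ n\<close>,
  which reduces the claim to the real case \<open>c = 1\<close>.\<close>

lemma bernoulli_fps_equation:
  fixes c :: complex
  shows "Abs_fps (\<lambda>n. of_real (bernoulli n / fact n) * c ^ n) * (fps_exp c - 1) = fps_const c * fps_X"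
proof (rule fps_ext)
  fix n :: nat
  \<comment> \<open>Numerator and denominator both have subdegree 1, so the division in
    \<open>bernoulli\<close> is exact.\<close>
  have "subdegree (fps_exp 1 - 1 :: real fps) = 1"
    by (rule subdegreeI) auto
  then have "fps_X / (fps_exp 1 - 1) * (fps_exp 1 - 1) = (fps_X :: real fps)"
    by (intro dvd_div_mult_self) (auto simp: fps_dvd_iff)
  then have "fps_nth (fps_X / (fps_exp 1 - 1) * (fps_exp 1 - 1)) n = fps_nth (fps_X :: real fps) n"
    by simp
  also have "fps_nth (fps_X / (fps_exp 1 - 1) * (fps_exp 1 - 1)) n =
      (\<Sum>i=0..n. bernoulli i / fact i * fps_nth (fps_exp 1 - 1) (n - i))"
    by (simp add: fps_mult_nth bernoulli_def)
  finally have *: "(\<Sum>i=0..n. bernoulli i / fact i * fps_nth (fps_exp 1 - 1) (n - i)) = fps_nth fps_X n" .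
  have "fps_nth (Abs_fps (\<lambda>n. of_real (bernoulli n / fact n) * c ^ n) * (fps_exp c - 1)) n =
      (\<Sum>i=0..n. of_real (bernoulli i / fact i) * c ^ i * fps_nth (fps_exp c - 1) (n - i))"
    by (simp add: fps_mult_nth)
  also have "\<dots> = (\<Sum>i=0..n. c ^ n * of_real (bernoulli i / fact i * fps_nth (fps_exp 1 - 1) (n - i)))"
  proof (rule sum.cong)
    fix i assume "i \<in> {0..n}"
    then have "c ^ n = c ^ i * c ^ (n - i)"
      by (simp flip: power_add)
    then show "of_real (bernoulli i / fact i) * c ^ i * fps_nth (fps_exp c - 1) (n - i) =
        c ^ n * of_real (bernoulli i / fact i * fps_nth (fps_exp 1 - 1) (n - i))"
      by simp
  qed auto
  also have "\<dots> = c ^ n * of_real (fps_nth fps_X n)"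
    unfolding sum_distrib_left[symmetric] of_real_sum[symmetric] * by simp
  also have "\<dots> = fps_nth (fps_const c * fps_X) n"
    by (simp add: fps_X_def)
  finally show "fps_nth (Abs_fps (\<lambda>n. of_real (bernoulli n / fact n) * c ^ n) * (fps_exp c - 1)) n =
      fps_nth (fps_const c * fps_X) n" .
qed

text \<open>With c = 2 pi i, the function pi z cot(pi z) is cz / (exp(cz) - 1) + i pi z. The linear
  summand does not affect even coefficients, so comparing these gives Euler's formula.\<close>

lemma zeta_nat_even:
  assumes "i \<ge> 1"
  shows "zeta_nat (2 * i) = of_real ((-1) ^ (i + 1) * bernoulli (2 * i) * (2 * pi) ^ (2 * i) / (2 * fact (2 * i)))"
proof -
  define c :: complex where "c = 2 * of_real pi * \<i>"
  define B where "B = Abs_fps (\<lambda>n. of_real (bernoulli n / fact n) * c ^ n)"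
  have "(B + fps_const (\<i> * of_real pi) * fps_X) * (fps_exp c - 1) =
      fps_const c * fps_X + fps_const (\<i> * of_real pi) * fps_X * (fps_exp c - 1)"
    unfolding B_def distrib_right bernoulli_fps_equation ..
  also have "fps_const c = 2 * fps_const (\<i> * of_real pi)"
    by (simp add: c_def numeral_fps_const mult_ac)
  also have "2 * fps_const (\<i> * of_real pi) * fps_X + fps_const (\<i> * of_real pi) * fps_X * (fps_exp c - 1)
      = fps_const (\<i> * of_real pi) * fps_X * (fps_exp c + 1)"
    by (simp add: algebra_simps)
  also have "\<dots> = cot_fps * (fps_exp c - 1)"
    unfolding c_def by (rule cot_fps_equation[symmetric])
  finally have eq: "(B + fps_const (\<i> * of_real pi) * fps_X) * (fps_exp c - 1) = cot_fps * (fps_exp c - 1)" .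
  have "fps_nth (fps_exp c - 1) 1 \<noteq> 0"
    by (simp add: c_def)
  then have "fps_exp c - 1 \<noteq> 0"
    by (metis fps_zero_nth)
  with eq have "fps_nth cot_fps (2 * i) = fps_nth (B + fps_const (\<i> * of_real pi) * fps_X) (2 * i)"
    by simp
  then have "- 2 * zeta_nat (2 * i) = of_real (bernoulli (2 * i) / fact (2 * i)) * c ^ (2 * i)"
    using assms by (simp add: B_def cot_fps_def)
  also have "c ^ (2 * i) = of_real ((-1) ^ i * (2 * pi) ^ (2 * i))"
    by (simp add: c_def power_mult_distrib power_mult power_minus[of "4 * (complex_of_real pi)\<^sup>2"])
  finally have *: "- 2 * zeta_nat (2 * i) =
      of_real (bernoulli (2 * i) / fact (2 * i)) * of_real ((-1) ^ i * (2 * pi) ^ (2 * i))" .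
  have "x = - y / 2" if "- 2 * x = y" for x y :: complex
    using that by auto
  from this[OF *] show ?thesis
    by (simp add: mult_ac)
qed

section \<open>Ramanujan's formula\<close>

context
  fixes t :: complex
  assumes t: "Im t > 0"
begin

lemma upper_half_nonzero: "t \<noteq> 0"
  using t by auto

lemma norm_linear_ge:
  fixes x y :: real
  shows "norm (of_real x * t + of_real y) \<ge> \<bar>x\<bar> * Im t"
    and "norm (of_real x * t + of_real y) \<ge> \<bar>y\<bar> * (Im t / norm t)"
proof -
  show "norm (of_real x * t + of_real y) \<ge> \<bar>x\<bar> * Im t"
    using abs_Im_le_cmod[of "of_real x * t + of_real y"] t by (simp add: abs_mult)
  \<comment> \<open>Multiplication by \<open>cnj t\<close> makes the coefficient of \<open>x\<close>
    real, so that only \<open>y\<close> contributes to the imaginary part.\<close>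
  have "\<bar>y\<bar> * Im t = \<bar>Im ((of_real x * t + of_real y) * cnj t)\<bar>"
    using t by (simp add: algebra_simps abs_mult)
  also have "\<dots> \<le> norm (of_real x * t + of_real y) * norm t"
    using abs_Im_le_cmod[of "(of_real x * t + of_real y) * cnj t"] by (simp add: norm_mult)
  finally have "\<bar>y\<bar> * Im t / norm t \<le> norm (of_real x * t + of_real y)"
    by (subst pos_divide_le_eq) (use upper_half_nonzero in auto)
  then show "norm (of_real x * t + of_real y) \<ge> \<bar>y\<bar> * (Im t / norm t)"
    by simp
qed

lemma norm_quadratic_ge:
  fixes n m :: nat
  shows "norm ((of_nat n * t)\<^sup>2 - of_nat m ^ 2) \<ge> real n ^ 2 * (Im t)\<^sup>2"
    and "norm ((of_nat n * t)\<^sup>2 - of_nat m ^ 2) \<ge> real m ^ 2 * (Im t / norm t)\<^sup>2"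
proof -
  have *: "norm ((of_nat n * t)\<^sup>2 - of_nat m ^ 2) =
      norm (of_real (real n) * t + of_real (- real m)) * norm (of_real (real n) * t + of_real (real m))"
    unfolding norm_mult[symmetric] by (simp add: power2_eq_square algebra_simps)
  have "(real n * Im t) * (real n * Im t) \<le> norm ((of_nat n * t)\<^sup>2 - of_nat m ^ 2)"
    unfolding * using norm_linear_ge(1)[of "real n" "- real m"] norm_linear_ge(1)[of "real n" "real m"] t
    by (intro mult_mono) auto
  then show "norm ((of_nat n * t)\<^sup>2 - of_nat m ^ 2) \<ge> real n ^ 2 * (Im t)\<^sup>2"
    by (simp add: power2_eq_square mult_ac)
  have "(real m * (Im t / norm t)) * (real m * (Im t / norm t)) \<le> norm ((of_nat n * t)\<^sup>2 - of_nat m ^ 2)"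
    unfolding * using norm_linear_ge(2)[of "- real m" "real n"] norm_linear_ge(2)[of "real m" "real n"] t
    by (intro mult_mono) auto
  then show "norm ((of_nat n * t)\<^sup>2 - of_nat m ^ 2) \<ge> real m ^ 2 * (Im t / norm t)\<^sup>2"
    by (simp add: power2_eq_square mult_ac)
qed

lemma quadratic_nonzero:
  fixes n m :: nat
  assumes "n \<ge> 1"
  shows "(of_nat n * t)\<^sup>2 - of_nat m ^ 2 \<noteq> 0"
proof -
  have "0 < real n ^ 2 * (Im t)\<^sup>2"
    using assms t by simp
  then show ?thesis
    using norm_quadratic_ge(1)[of n m] by (metis norm_zero not_less)
qed

text \<open>The power in front already gives decay in one variable, with exponent at least 2. Of the
  two lower bounds for the quadratic factor, the one in the other variable is used, which leaves a
  product majorant.\<close>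

lemma summable_on_lattice:
  assumes "p \<ge> 1"
  shows "(\<lambda>(n, m). 1 / ((of_nat n * t) ^ (2 * p) * ((of_nat n * t)\<^sup>2 - of_nat m ^ 2))) summable_on {1..} \<times> {1..}"
    and "(\<lambda>(n, m). 1 / (of_nat m ^ (2 * p) * ((of_nat n * t)\<^sup>2 - of_nat m ^ 2))) summable_on {1..} \<times> {1..}"
proof -
  have s: "(\<lambda>(n, m). C * (1 / real n ^ k * (1 / real m ^ l))) summable_on {1..} \<times> {1..}"
    if "k \<ge> 2" "l \<ge> 2" for C k l
    using summable_on_cmult_right[OF summable_on_times_nonneg[OF summable_on_inverse_power[OF that(1)]
          summable_on_inverse_power[OF that(2)]], of C]
    by (simp add: case_prod_unfold)
  show "(\<lambda>(n, m). 1 / ((of_nat n * t) ^ (2 * p) * ((of_nat n * t)\<^sup>2 - of_nat m ^ 2))) summable_on {1..} \<times> {1..}"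
  proof (rule summable_on_complex_bound[OF s])
    fix x :: "nat \<times> nat" assume "x \<in> {1..} \<times> {1..}"
    then obtain n m where x: "x = (n, m)" "n \<ge> 1" "m \<ge> 1" by auto
    have "norm (1 / ((of_nat n * t) ^ (2 * p) * ((of_nat n * t)\<^sup>2 - of_nat m ^ 2))) =
        1 / (real n ^ (2 * p) * norm t ^ (2 * p) * norm ((of_nat n * t)\<^sup>2 - of_nat m ^ 2))"
      by (simp add: norm_divide norm_mult norm_power power_mult_distrib)
    also have "\<dots> \<le> 1 / (real n ^ (2 * p) * norm t ^ (2 * p) * (real m ^ 2 * (Im t / norm t)\<^sup>2))"
      using x t quadratic_nonzero[of n m]
      by (intro divide_left_mono mult_left_mono norm_quadratic_ge mult_pos_pos) (auto simp: upper_half_nonzero)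
    finally show "norm (case x of (n, m) \<Rightarrow> 1 / ((of_nat n * t) ^ (2 * p) * ((of_nat n * t)\<^sup>2 - of_nat m ^ 2))) \<le>
      (case x of (n, m) \<Rightarrow> (1 / (norm t ^ (2 * p) * (Im t / norm t)\<^sup>2)) * (1 / real n ^ (2 * p) * (1 / real m ^ 2)))"
      by (simp add: x(1) mult_ac)
  qed (use assms in auto)
  show "(\<lambda>(n, m). 1 / (of_nat m ^ (2 * p) * ((of_nat n * t)\<^sup>2 - of_nat m ^ 2))) summable_on {1..} \<times> {1..}"
  proof (rule summable_on_complex_bound[OF s])
    fix x :: "nat \<times> nat" assume "x \<in> {1..} \<times> {1..}"
    then obtain n m where x: "x = (n, m)" "n \<ge> 1" "m \<ge> 1" by auto
    have "norm (1 / (of_nat m ^ (2 * p) * ((of_nat n * t)\<^sup>2 - of_nat m ^ 2))) =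
        1 / (real m ^ (2 * p) * norm ((of_nat n * t)\<^sup>2 - of_nat m ^ 2))"
      by (simp add: norm_divide norm_mult norm_power)
    also have "\<dots> \<le> 1 / (real m ^ (2 * p) * (real n ^ 2 * (Im t)\<^sup>2))"
      using x t quadratic_nonzero[of n m]
      by (intro divide_left_mono mult_left_mono norm_quadratic_ge mult_pos_pos) auto
    finally show "norm (case x of (n, m) \<Rightarrow> 1 / (of_nat m ^ (2 * p) * ((of_nat n * t)\<^sup>2 - of_nat m ^ 2))) \<le>
      (case x of (n, m) \<Rightarrow> (1 / (Im t)\<^sup>2) * (1 / real n ^ 2 * (1 / real m ^ (2 * p))))"
      by (simp add: x(1) mult_ac)
  qed (use assms in auto)
qed

end

text \<open>Iteration of 1/(u(u-v)) = 1/(v(u-v)) - 1/(uv): each step trades one factor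
  \<open>u\<close> for a factor \<open>v\<close>. The finite sum is what later becomes the products
  of even zeta values.\<close>

lemma partial_fraction_powers:
  fixes u v :: complex
  assumes "u \<noteq> 0" "v \<noteq> 0" "u - v \<noteq> 0"
  shows "1 / (u ^ p * (u - v)) = 1 / (v ^ p * (u - v)) - (\<Sum>i<p. 1 / u ^ (p - i) * (1 / v ^ (i + 1)))"
proof (induction p)
  case (Suc p)
  have "1 / (u ^ Suc p * (u - v)) = 1 / u * (1 / (u ^ p * (u - v)))"
    by simp
  also have "\<dots> = 1 / u * (1 / (v ^ p * (u - v))) - (\<Sum>i<p. 1 / u ^ (Suc p - i) * (1 / v ^ (i + 1)))"
    unfolding Suc right_diff_distrib[of "1 / u"] sum_distrib_left
    by (intro arg_cong2[of _ _ _ _ minus] sum.cong refl) (auto simp: Suc_diff_le)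
  also have "1 / u * (1 / (v ^ p * (u - v))) = 1 / (v ^ Suc p * (u - v)) - 1 / u * (1 / v ^ (p + 1))"
  proof -
    have "1 / (u * (u - v)) = 1 / (v * (u - v)) - 1 / (u * v)"
      using assms by (simp add: divide_simps)
    then have "1 / v ^ p * (1 / (u * (u - v))) = 1 / v ^ p * (1 / (v * (u - v)) - 1 / (u * v))"
      by simp
    then show ?thesis
      unfolding right_diff_distrib[of "1 / v ^ p"] by (simp add: mult_ac)
  qed
  finally show ?case
    by (simp add: algebra_simps)
qed auto

lemma has_sum_finite_sum:
  fixes f :: "'i \<Rightarrow> 'a \<Rightarrow> 'b :: topological_comm_monoid_add"
  assumes "\<And>i. i \<in> I \<Longrightarrow> (f i has_sum s i) A"
  shows "((\<lambda>x. \<Sum>i\<in>I. f i x) has_sum (\<Sum>i\<in>I. s i)) A"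
  using assms by (induction I rule: infinite_finite_induct) (auto intro!: has_sum_add)

definition cot_sum :: "nat \<Rightarrow> complex \<Rightarrow> complex" where
  "cot_sum c t = (\<Sum>\<^sub>\<infinity>n\<in>{1..}. of_real pi * cot (of_real pi * (of_nat n * t)) / of_nat n ^ c)"

lemma not_Int_if_Im_nonzero: "Im z \<noteq> 0 \<Longrightarrow> z \<notin> \<int>"
  by (auto elim!: Ints_cases)

text \<open>Expanding the cotangents turns the sum at \<open>t\<close> into a double series
  \<open>X\<close> and the sum at \<open>- 1 / t\<close> into a double series \<open>Y\<close>.
  These differ by finitely many series that factor into zeta values. The \<open>1 / z\<close> terms
  of the expansions account for \<open>zeta_nat (2 * p + 2)\<close>.\<close>

lemma cot_sum_transformation:
  fixes t :: complex
  assumes t: "Im t > 0" and p: "p \<ge> 1"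
  shows "cot_sum (2 * p + 1) t = t ^ (2 * p) * cot_sum (2 * p + 1) (- 1 / t)
      + (1 / t + t ^ (2 * p + 1)) * zeta_nat (2 * p + 2)
      - 2 * (\<Sum>i<p. t ^ (2 * i + 1) * zeta_nat (2 * (p - i)) * zeta_nat (2 * (i + 1)))"
proof -
  have nz: "t \<noteq> 0" using t by auto
  \<comment> \<open>\<open>f\<close>, \<open>g\<close> and \<open>h i\<close> are the terms of
    \<open>partial_fraction_powers\<close> for \<open>u = (n t)\<^sup>2\<close> and
    \<open>v = m\<^sup>2\<close>.\<close>
  define f where "f = (\<lambda>(n :: nat, m :: nat). 1 / ((of_nat n * t) ^ (2 * p) * ((of_nat n * t)\<^sup>2 - of_nat m ^ 2)))"
  define g where "g = (\<lambda>(n :: nat, m :: nat). 1 / (of_nat m ^ (2 * p) * ((of_nat n * t)\<^sup>2 - of_nat m ^ 2)))"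
  define h where "h = (\<lambda>i (n :: nat, m :: nat). 1 / (of_nat n * t) ^ (2 * (p - i)) * (1 / of_nat m ^ (2 * (i + 1))))"
  define X where "X = infsum f ({1..} \<times> {1..})"
  define Y where "Y = infsum g ({1..} \<times> {1..})"
  have X: "(f has_sum X) ({1..} \<times> {1..})" and Y: "(g has_sum Y) ({1..} \<times> {1..})"
    using summable_on_lattice[OF assms] by (simp_all add: X_def Y_def f_def g_def)
  have Z: "(h i has_sum 1 / t ^ (2 * (p - i)) * zeta_nat (2 * (p - i)) * zeta_nat (2 * (i + 1))) ({1..} \<times> {1..})"
    if i: "i < p" for i
  proof (rule has_sum_SigmaI)
    show "((\<lambda>m. h i (n, m)) has_sum 1 / (of_nat n * t) ^ (2 * (p - i)) * zeta_nat (2 * (i + 1))) {1..}" for n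
      unfolding h_def prod.case by (intro has_sum_cmult_right has_sum_zeta_nat) auto
    have "((\<lambda>n. 1 / t ^ (2 * (p - i)) * (1 / of_nat n ^ (2 * (p - i))) * zeta_nat (2 * (i + 1))) has_sum
        1 / t ^ (2 * (p - i)) * zeta_nat (2 * (p - i)) * zeta_nat (2 * (i + 1))) {1..}"
      using i by (intro has_sum_cmult_left has_sum_cmult_right has_sum_zeta_nat) auto
    then show "((\<lambda>n. 1 / (of_nat n * t) ^ (2 * (p - i)) * zeta_nat (2 * (i + 1))) has_sum
        1 / t ^ (2 * (p - i)) * zeta_nat (2 * (p - i)) * zeta_nat (2 * (i + 1))) {1..}"
      by (simp add: power_mult_distrib mult_ac)
    have "(\<lambda>(n, m). 1 / real n ^ (2 * (p - i)) * (1 / real m ^ (2 * (i + 1)))) summable_on {1..} \<times> {1..}"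
      using i by (intro summable_on_times_nonneg summable_on_inverse_power) auto
    then have "(\<lambda>x. 1 / norm t ^ (2 * (p - i)) * (case x of (n, m) \<Rightarrow> 1 / real n ^ (2 * (p - i)) * (1 / real m ^ (2 * (i + 1)))))
        summable_on {1..} \<times> {1..}"
      by (rule summable_on_cmult_right)
    then show "h i summable_on {1..} \<times> {1..}"
      by (rule summable_on_complex_bound)
         (auto simp: h_def norm_divide norm_mult norm_power power_mult_distrib mult_ac)
  qed
  have XY: "X = Y - (\<Sum>i<p. 1 / t ^ (2 * (p - i)) * zeta_nat (2 * (p - i)) * zeta_nat (2 * (i + 1)))"
  proof (rule has_sum_unique[OF X])
    have "((\<lambda>x. g x - (\<Sum>i<p. h i x)) has_sum
        (Y - (\<Sum>i<p. 1 / t ^ (2 * (p - i)) * zeta_nat (2 * (p - i)) * zeta_nat (2 * (i + 1))))) ({1..} \<times> {1..})"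
      unfolding diff_conv_add_uminus using Y Z
      by (intro has_sum_add has_sum_uminusI has_sum_finite_sum) auto
    also have "?this \<longleftrightarrow> (f has_sum
        (Y - (\<Sum>i<p. 1 / t ^ (2 * (p - i)) * zeta_nat (2 * (p - i)) * zeta_nat (2 * (i + 1))))) ({1..} \<times> {1..})"
    proof (rule has_sum_cong)
      fix x :: "nat \<times> nat" assume "x \<in> {1..} \<times> {1..}"
      then obtain n m where x: "x = (n, m)" "n \<ge> 1" "m \<ge> 1" by auto
      have "f x = g x - (\<Sum>i<p. h i x)"
        unfolding x(1) f_def g_def h_def prod.case power_mult
        by (rule partial_fraction_powers) (use nz x quadratic_nonzero[OF t, of n m] in auto)
      then show "g x - (\<Sum>i<p. h i x) = f x" ..
    qed
    finally show "(f has_sum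
        (Y - (\<Sum>i<p. 1 / t ^ (2 * (p - i)) * zeta_nat (2 * (p - i)) * zeta_nat (2 * (i + 1))))) ({1..} \<times> {1..})" .
  qed
  \<comment> \<open>Here \<open>m\<close> is summed first, by partial fractions at
    \<open>n t\<close>.\<close>
  have A1: "cot_sum (2 * p + 1) t = zeta_nat (2 * p + 2) / t + 2 * t ^ (2 * p + 1) * X"
  proof -
    have "((\<lambda>x. 2 * t ^ (2 * p + 1) * f x) has_sum 2 * t ^ (2 * p + 1) * X) ({1..} \<times> {1..})"
      using X by (rule has_sum_cmult_right)
    then have "((\<lambda>n. (of_real pi * cot (of_real pi * (of_nat n * t)) - 1 / (of_nat n * t)) * (1 / of_nat n ^ (2 * p + 1)))
        has_sum 2 * t ^ (2 * p + 1) * X) {1..}"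
    proof (rule has_sum_SigmaD)
      fix n :: nat assume n: "n \<in> {1..}"
      then have "of_nat n * t \<notin> \<int>"
        using t by (intro not_Int_if_Im_nonzero) auto
      then have "((\<lambda>m. 2 * (of_nat n * t) / ((of_nat n * t)\<^sup>2 - of_nat m ^ 2) * (1 / of_nat n ^ (2 * p + 1))) has_sum
         (of_real pi * cot (of_real pi * (of_nat n * t)) - 1 / (of_nat n * t)) * (1 / of_nat n ^ (2 * p + 1))) {1..}"
        by (intro has_sum_cmult_left cot_partial_fractions)
      moreover have "2 * (of_nat n * t) / ((of_nat n * t)\<^sup>2 - of_nat m ^ 2) * (1 / of_nat n ^ (2 * p + 1)) =
          2 * t ^ (2 * p + 1) * f (n, m)" for m
        using n nz by (simp add: f_def power_mult_distrib)
      ultimately show "((\<lambda>m. 2 * t ^ (2 * p + 1) * f (n, m)) has_sum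
         (of_real pi * cot (of_real pi * (of_nat n * t)) - 1 / (of_nat n * t)) * (1 / of_nat n ^ (2 * p + 1))) {1..}"
        by simp
    qed
    moreover have "((\<lambda>n. 1 / t * (1 / of_nat n ^ (2 * p + 2))) has_sum 1 / t * zeta_nat (2 * p + 2)) {1..}"
      by (intro has_sum_cmult_right has_sum_zeta_nat) auto
    ultimately have "((\<lambda>n. (of_real pi * cot (of_real pi * (of_nat n * t)) - 1 / (of_nat n * t)) * (1 / of_nat n ^ (2 * p + 1))
          + 1 / t * (1 / of_nat n ^ (2 * p + 2))) has_sum 2 * t ^ (2 * p + 1) * X + 1 / t * zeta_nat (2 * p + 2)) {1..}"
      by (rule has_sum_add)
    also have "?this \<longleftrightarrow> ((\<lambda>n. of_real pi * cot (of_real pi * (of_nat n * t)) / of_nat n ^ (2 * p + 1)) has_sum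
        2 * t ^ (2 * p + 1) * X + 1 / t * zeta_nat (2 * p + 2)) {1..}"
      by (intro has_sum_cong) (auto simp: diff_divide_distrib mult_ac)
    finally show ?thesis
      by (simp add: cot_sum_def infsumI)
  qed
  \<comment> \<open>Here \<open>n\<close> is summed first, by partial fractions at
    \<open>- m / t\<close>; their denominators are the old quadratic factor up to
    \<open>- 1 / t\<^sup>2\<close>.\<close>
  have A2: "cot_sum (2 * p + 1) (- 1 / t) = - t * zeta_nat (2 * p + 2) + 2 * t * Y"
  proof -
    have "((\<lambda>(m, n). g (n, m)) has_sum Y) ({1..} \<times> {1..})"
      using Y by (subst (asm) has_sum_swap)
    then have "((\<lambda>x. 2 * t * (case x of (m, n) \<Rightarrow> g (n, m))) has_sum 2 * t * Y) ({1..} \<times> {1..})"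
      by (rule has_sum_cmult_right)
    then have "((\<lambda>m. (of_real pi * cot (of_real pi * (of_nat m * (- 1 / t))) - 1 / (of_nat m * (- 1 / t))) * (1 / of_nat m ^ (2 * p + 1)))
        has_sum 2 * t * Y) {1..}"
    proof (rule has_sum_SigmaD)
      fix m :: nat assume m: "m \<in> {1..}"
      have "Im (of_nat m * (- 1 / t)) > 0"
        using m t by (simp add: Im_divide divide_neg_pos add_pos_nonneg sum_power2_gt_zero_iff)
      then have "of_nat m * (- 1 / t) \<notin> \<int>"
        by (intro not_Int_if_Im_nonzero) auto
      then have "((\<lambda>n. 2 * (of_nat m * (- 1 / t)) / ((of_nat m * (- 1 / t))\<^sup>2 - of_nat n ^ 2) * (1 / of_nat m ^ (2 * p + 1))) has_sum
         (of_real pi * cot (of_real pi * (of_nat m * (- 1 / t))) - 1 / (of_nat m * (- 1 / t))) * (1 / of_nat m ^ (2 * p + 1))) {1..}"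
        by (intro has_sum_cmult_left cot_partial_fractions)
      also have "?this \<longleftrightarrow> ((\<lambda>n. 2 * t * g (n, m)) has_sum
         (of_real pi * cot (of_real pi * (of_nat m * (- 1 / t))) - 1 / (of_nat m * (- 1 / t))) * (1 / of_nat m ^ (2 * p + 1))) {1..}"
      proof (rule has_sum_cong)
        fix n :: nat assume n: "n \<in> {1..}"
        define Q where "Q = (of_nat n * t)\<^sup>2 - of_nat m ^ 2"
        have Q: "Q \<noteq> 0"
          using n quadratic_nonzero[OF t] by (auto simp: Q_def)
        have "(of_nat m * (- 1 / t))\<^sup>2 - of_nat n ^ 2 = - Q / t\<^sup>2"
          using nz by (simp add: Q_def field_simps)
        then show "2 * (of_nat m * (- 1 / t)) / ((of_nat m * (- 1 / t))\<^sup>2 - of_nat n ^ 2) * (1 / of_nat m ^ (2 * p + 1)) = 2 * t * g (n, m)"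
          using m Q nz unfolding g_def prod.case Q_def[symmetric] by (simp add: power2_eq_square[of t])
      qed
      finally show "((\<lambda>n. 2 * t * (case (m, n) of (m, n) \<Rightarrow> g (n, m))) has_sum
         (of_real pi * cot (of_real pi * (of_nat m * (- 1 / t))) - 1 / (of_nat m * (- 1 / t))) * (1 / of_nat m ^ (2 * p + 1))) {1..}"
        by simp
    qed
    moreover have "((\<lambda>m. - t * (1 / of_nat m ^ (2 * p + 2))) has_sum - t * zeta_nat (2 * p + 2)) {1..}"
      by (intro has_sum_cmult_right has_sum_zeta_nat) auto
    ultimately have "((\<lambda>m. (of_real pi * cot (of_real pi * (of_nat m * (- 1 / t))) - 1 / (of_nat m * (- 1 / t))) * (1 / of_nat m ^ (2 * p + 1))
          + - t * (1 / of_nat m ^ (2 * p + 2))) has_sum 2 * t * Y + - t * zeta_nat (2 * p + 2)) {1..}"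
      by (rule has_sum_add)
    also have "?this \<longleftrightarrow> ((\<lambda>m. of_real pi * cot (of_real pi * (of_nat m * (- 1 / t))) / of_nat m ^ (2 * p + 1)) has_sum
        2 * t * Y + - t * zeta_nat (2 * p + 2)) {1..}"
      by (intro has_sum_cong) (auto simp: diff_divide_distrib mult_ac)
    finally show ?thesis
      by (simp add: cot_sum_def infsumI)
  qed
  have e: "2 * t ^ (2 * p + 1) * (\<Sum>i<p. 1 / t ^ (2 * (p - i)) * zeta_nat (2 * (p - i)) * zeta_nat (2 * (i + 1)))
      = 2 * (\<Sum>i<p. t ^ (2 * i + 1) * zeta_nat (2 * (p - i)) * zeta_nat (2 * (i + 1)))"
    unfolding mult.assoc sum_distrib_left
  proof (rule sum.cong)
    fix i assume "i \<in> {..<p}"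
    then have "2 * p + 1 = (2 * i + 1) + 2 * (p - i)"
      by simp
    then have "t ^ (2 * p + 1) = t ^ (2 * i + 1) * t ^ (2 * (p - i))"
      by (metis power_add)
    then show "2 * (t ^ (2 * p + 1) * (1 / t ^ (2 * (p - i)) * (zeta_nat (2 * (p - i)) * zeta_nat (2 * (i + 1))))) =
        2 * (t ^ (2 * i + 1) * (zeta_nat (2 * (p - i)) * zeta_nat (2 * (i + 1))))"
      using nz by simp
  qed simp
  define S where "S = (\<Sum>i<p. t ^ (2 * i + 1) * zeta_nat (2 * (p - i)) * zeta_nat (2 * (i + 1)))"
  have "cot_sum (2 * p + 1) t = zeta_nat (2 * p + 2) / t + 2 * t ^ (2 * p + 1) * Y - 2 * S"
    unfolding A1 XY right_diff_distrib e S_def by simp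
  also have "2 * t ^ (2 * p + 1) * Y = t ^ (2 * p) * (- t * zeta_nat (2 * p + 2) + 2 * t * Y)
      + t ^ (2 * p + 1) * zeta_nat (2 * p + 2)"
    by (simp add: algebra_simps)
  finally show ?thesis
    unfolding A2 S_def by (simp add: algebra_simps)
qed

section \<open>Lambert series with exponent \<open>-c\<close> and their link to the cotangent
  sums\<close>

definition lambert :: "nat \<Rightarrow> complex \<Rightarrow> complex" where
  "lambert c q = (\<Sum>\<^sub>\<infinity>n\<in>{1..}. 1 / of_nat n ^ c * (q ^ n / (1 - q ^ n)))"

lemma power_neq_1:
  fixes q :: complex
  assumes "norm q < 1" "n \<ge> 1"
  shows "q ^ n \<noteq> 1"
proof
  assume "q ^ n = 1"
  then have "norm q ^ n = 1"
    by (metis norm_one norm_power)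
  moreover have "norm q ^ n < 1"
    using assms by (simp add: power_less_one_iff)
  ultimately show False by simp
qed

lemma summable_on_lambert:
  fixes q :: complex
  assumes q: "norm q < 1"
  shows "(\<lambda>n. 1 / of_nat n ^ c * (q ^ n / (1 - q ^ n))) summable_on {1..}"
proof (rule summable_on_complex_bound)
  show "(\<lambda>n. 1 / (1 - norm q) * norm q ^ n) summable_on {1..}"
    using has_sum_imp_summable[OF has_sum_geometric_from_1[of "norm q"]] q
    by (intro summable_on_cmult_right) auto
next
  fix n :: nat assume n: "n \<in> {1..}"
  have "1 - norm q \<le> 1 - norm q ^ n"
    using n q power_decreasing[of 1 n "norm q"] by auto
  also have "\<dots> \<le> norm (1 - q ^ n)"
    using norm_triangle_ineq2[of 1 "q ^ n"] by (simp add: norm_power)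
  finally have "norm q ^ n / norm (1 - q ^ n) \<le> norm q ^ n / (1 - norm q)"
    using n q power_neq_1[OF q, of n] by (intro divide_left_mono mult_pos_pos) auto
  moreover have "1 / real n ^ c \<le> 1"
    using n by simp
  ultimately have "1 / real n ^ c * (norm q ^ n / norm (1 - q ^ n)) \<le> 1 * (norm q ^ n / (1 - norm q))"
    by (intro mult_mono) auto
  then show "norm (1 / of_nat n ^ c * (q ^ n / (1 - q ^ n))) \<le> 1 / (1 - norm q) * norm q ^ n"
    by (simp add: norm_mult norm_divide norm_power)
qed

lemma has_sum_lambert:
  assumes "norm q < 1"
  shows "((\<lambda>n. 1 / of_nat n ^ c * (q ^ n / (1 - q ^ n))) has_sum lambert c q) {1..}"
  using summable_on_lambert[OF assms] by (simp add: lambert_def)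

lemma norm_exp_less_1:
  assumes "Im t > 0"
  shows "norm (exp (2 * of_real pi * \<i> * t)) < 1"
  using assms by simp

text \<open>With \<open>q ^ n = exp (2 pi i n t)\<close>, the cotangent at pi n t is -i times
  \<open>1 + 2 * (q ^ n / (1 - q ^ n))\<close>; the constant 1 sums to the zeta value.\<close>

lemma cot_sum_eq_lambert:
  assumes t: "Im t > 0" and c: "c \<ge> 2"
  shows "cot_sum c t = - \<i> * of_real pi * (zeta_nat c + 2 * lambert c (exp (2 * of_real pi * \<i> * t)))"
proof -
  define q where "q = exp (2 * of_real pi * \<i> * t)"
  have q: "norm q < 1"
    unfolding q_def using t by (rule norm_exp_less_1)
  have "((\<lambda>n. - \<i> * of_real pi * (1 / of_nat n ^ c + 2 * (1 / of_nat n ^ c * (q ^ n / (1 - q ^ n))))) has_sum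
      - \<i> * of_real pi * (zeta_nat c + 2 * lambert c q)) {1..}"
    by (intro has_sum_cmult_right has_sum_add has_sum_zeta_nat has_sum_lambert c q)
  also have "?this \<longleftrightarrow> ((\<lambda>n. of_real pi * cot (of_real pi * (of_nat n * t)) / of_nat n ^ c) has_sum
      - \<i> * of_real pi * (zeta_nat c + 2 * lambert c q)) {1..}"
  proof (rule has_sum_cong)
    fix n :: nat assume n: "n \<in> {1..}"
    have qn: "exp (2 * of_real pi * \<i> * (of_nat n * t)) = q ^ n"
      by (simp add: q_def mult_ac flip: exp_of_nat_mult)
    have neq: "q ^ n \<noteq> 1"
      using power_neq_1[OF q] n by simp
    then have "cot (of_real pi * (of_nat n * t)) = \<i> * (q ^ n + 1) / (q ^ n - 1)"
      using cot_pi_exp[of "of_nat n * t"] by (simp add: qn)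
    also have "\<dots> = - \<i> * (1 + 2 * (q ^ n / (1 - q ^ n)))"
      using neq by (simp add: divide_simps) (simp add: algebra_simps)
    finally have ct: "cot (of_real pi * (of_nat n * t)) = - \<i> * (1 + 2 * (q ^ n / (1 - q ^ n)))" .
    show "- \<i> * of_real pi * (1 / of_nat n ^ c + 2 * (1 / of_nat n ^ c * (q ^ n / (1 - q ^ n)))) =
        of_real pi * cot (of_real pi * (of_nat n * t)) / of_nat n ^ c"
      unfolding ct by (simp only: divide_inverse) (simp add: algebra_simps)
  qed
  finally show ?thesis
    unfolding cot_sum_def q_def by (rule infsumI)
qed

lemma bernoulli_0: "bernoulli 0 = 1"
proof -
  have "fps_nth (Abs_fps (\<lambda>n. of_real (bernoulli n / fact n) * 1 ^ n) * (fps_exp 1 - 1)) 1 =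
      fps_nth (fps_const 1 * fps_X :: complex fps) 1"
    unfolding bernoulli_fps_equation ..
  then show ?thesis
    by (simp add: fps_mult_nth)
qed

text \<open>The transformation of \<open>cot_sum\<close> with every ingredient evaluated. The two
  multiples of \<open>zeta_nat (2 * p + 2)\<close> become the end terms \<open>j = 0\<close> and
  \<open>j = p + 1\<close> of the Bernoulli sum.\<close>

theorem ramanujan_formula:
  fixes t :: complex
  assumes t: "Im t > 0" and p: "p \<ge> 1" and c: "c = 2 * p + 1"
  defines "F \<equiv> \<lambda>t. lambert c (exp (2 * of_real pi * \<i> * t))"
  defines "B \<equiv> \<lambda>j. bernoulli (2 * j) / fact (2 * j)"
  shows "zeta_nat c + 2 * F t = t ^ (2 * p) * (zeta_nat c + 2 * F (- 1 / t))
     + (-1) ^ p * \<i> * (2 * of_real pi) ^ c / t * (\<Sum>j\<le>p + 1. t ^ (2 * j) * of_real (B j * B (p + 1 - j)))"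
proof -
  have nz: "t \<noteq> 0" using t by auto
  \<comment> \<open>\<open>Z\<close> extends Euler's formula to \<open>j = 0\<close>, with value
    -1/2 there. This is what lets the end terms join the convolution \<open>S\<close>.\<close>
  define Z :: "nat \<Rightarrow> complex" where "Z = (\<lambda>j. of_real ((-1) ^ (j + 1) * B j * (2 * pi) ^ (2 * j) / 2))"
  have Z: "zeta_nat (2 * j) = Z j" if "j \<ge> 1" for j
    using zeta_nat_even[OF that] by (simp add: Z_def B_def mult_ac)
  have Z0: "Z 0 = - 1 / 2"
    by (simp add: Z_def B_def bernoulli_0)
  have "Im (- 1 / t) > 0"
    using t by (simp add: Im_divide divide_neg_pos add_pos_nonneg sum_power2_gt_zero_iff)
  then have cot: "cot_sum c t = - \<i> * of_real pi * (zeta_nat c + 2 * F t)"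
    "cot_sum c (- 1 / t) = - \<i> * of_real pi * (zeta_nat c + 2 * F (- 1 / t))"
    using t p by (simp_all only: F_def) (intro cot_sum_eq_lambert; simp add: c)+
  define S where "S = (\<Sum>j\<le>p + 1. t ^ (2 * j) * (Z j * Z (p + 1 - j)))"
  have "S = Z 0 * Z (p + 1) + (\<Sum>i<p. t ^ (2 * (i + 1)) * (Z (i + 1) * Z (p - i))) + t ^ (2 * (p + 1)) * (Z (p + 1) * Z 0)"
    unfolding S_def Suc_eq_plus1[symmetric] sum.atMost_Suc sum.atMost_shift by simp
  also have "\<dots> = - 1 / 2 * (1 + t ^ (2 * (p + 1))) * zeta_nat (2 * p + 2) + t * (\<Sum>i<p. t ^ (2 * i + 1) * zeta_nat (2 * (p - i)) * zeta_nat (2 * (i + 1)))"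
  proof -
    have "(\<Sum>i<p. t ^ (2 * (i + 1)) * (Z (i + 1) * Z (p - i))) =
        t * (\<Sum>i<p. t ^ (2 * i + 1) * zeta_nat (2 * (p - i)) * zeta_nat (2 * (i + 1)))"
      unfolding sum_distrib_left
    proof (rule sum.cong)
      fix i assume "i \<in> {..<p}"
      then have "zeta_nat (2 * (p - i)) = Z (p - i)" "zeta_nat (2 * (i + 1)) = Z (i + 1)"
        by (intro Z; simp)+
      then show "t ^ (2 * (i + 1)) * (Z (i + 1) * Z (p - i)) =
          t * (t ^ (2 * i + 1) * zeta_nat (2 * (p - i)) * zeta_nat (2 * (i + 1)))"
        by (simp only:) simp
    qed simp
    moreover have "zeta_nat (2 * p + 2) = Z (p + 1)"
      using Z[of "p + 1"] by simp
    ultimately show ?thesis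
      by (simp add: Z0 algebra_simps)
  qed
  finally have "- 2 / t * S = (1 / t + t ^ (2 * p + 1)) * zeta_nat (2 * p + 2)
      - 2 * (\<Sum>i<p. t ^ (2 * i + 1) * zeta_nat (2 * (p - i)) * zeta_nat (2 * (i + 1)))"
    using nz by (simp add: field_simps)
  with cot_sum_transformation[OF t p] have *: "cot_sum c t = t ^ (2 * p) * cot_sum c (- 1 / t) - 2 / t * S"
    by (simp add: c)
  have S_eq: "S = (\<Sum>j\<le>p + 1. (-1) ^ (p + 1) * (2 * of_real pi) ^ (c + 1) / 4 * (t ^ (2 * j) * of_real (B j * B (p + 1 - j))))"
    unfolding S_def
  proof (rule sum.cong)
    fix j assume "j \<in> {..p + 1}"
    then obtain l where l: "p + 1 = j + l" 
      by (auto simp: le_iff_add)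
    have s: "(-1) ^ (j + 1) * (-1) ^ (l + 1) = (-1 :: complex) ^ (p + 1)"
      "(2 * of_real pi :: complex) ^ (2 * j) * (2 * of_real pi) ^ (2 * l) = (2 * of_real pi) ^ (c + 1)"
    proof -
      have "c + 1 = 2 * j + 2 * l" using c l by simp
      then show "(2 * of_real pi :: complex) ^ (2 * j) * (2 * of_real pi) ^ (2 * l) = (2 * of_real pi) ^ (c + 1)"
        by (simp only: power_add)
    qed (simp only: l, simp add: power_add)
    have "Z j * Z l = ((-1) ^ (j + 1) * (-1) ^ (l + 1)) * ((2 * of_real pi) ^ (2 * j) * (2 * of_real pi) ^ (2 * l)) / 4 * of_real (B j * B l)"
      unfolding Z_def by simp
    then have ZZ: "Z j * Z l = (-1) ^ (p + 1) * (2 * of_real pi) ^ (c + 1) / 4 * of_real (B j * B l)"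
      unfolding s .
    have pl: "p + 1 - j = l"
      using l by simp
    show "t ^ (2 * j) * (Z j * Z (p + 1 - j)) = (-1) ^ (p + 1) * (2 * of_real pi) ^ (c + 1) / 4 * (t ^ (2 * j) * of_real (B j * B (p + 1 - j)))"
      unfolding pl ZZ by (simp only: mult_ac)
  qed simp
  define R where "R = (\<Sum>j\<le>p + 1. t ^ (2 * j) * of_real (B j * B (p + 1 - j)))"
  have S: "S = - ((-1) ^ p * (2 * of_real pi) ^ c * of_real pi / 2) * R"
    unfolding S_eq sum_distrib_left[symmetric] R_def[symmetric] by simp
  define W1 where "W1 = zeta_nat c + 2 * F t"
  define W2 where "W2 = zeta_nat c + 2 * F (- 1 / t)"
  have "- \<i> * of_real pi * W1 = - \<i> * of_real pi * (t ^ (2 * p) * W2 + (-1) ^ p * \<i> * (2 * of_real pi) ^ c / t * R)"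
    using * unfolding cot S W1_def[symmetric] W2_def[symmetric] R_def[symmetric]
    using nz by (simp add: algebra_simps)
  then show ?thesis
    unfolding W1_def W2_def R_def by simp
qed

section \<open>Specialization\<close>

text \<open>Split by the parity of \<open>n\<close>. The even terms of the series at
  \<open>q\<close> form a multiple of the series at \<open>q\<^sup>2\<close>. For odd
  \<open>n\<close> and \<open>w = q ^ n\<close>, the identity w/(1-w) - w/(1+w) = 2w^2/(1-w^2) shows
  that the odd parts at \<open>q\<close> and \<open>- q\<close> add up to twice the odd part at
  \<open>q\<^sup>2\<close>.\<close>

lemma lambert_add_neg:
  fixes q :: complex
  assumes q: "norm q < 1"
  shows "lambert c q + lambert c (- q) = 2 * (1 + 1 / 2 ^ c) * lambert c (q\<^sup>2) - 2 / 2 ^ c * lambert c (q ^ 4)"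
proof -
  define f where "f = (\<lambda>q n. 1 / of_nat n ^ c * (q ^ n / (1 - q ^ n :: complex)))"
  define O' where "O' = (\<lambda>q. infsum (f q) {n. odd n})"
  have sum: "f q summable_on {1..}" if "norm q < 1" for q
    using summable_on_lambert[OF that] by (simp add: f_def)
  have odd: "(f q has_sum O' q) {n. odd n}" if "norm q < 1" for q
    unfolding O'_def
    by (intro has_sum_infsum summable_on_subset_banach[OF sum[OF that]]) (auto simp: odd_pos Suc_le_eq)
  have split: "lambert c q = O' q + 1 / 2 ^ c * lambert c (q\<^sup>2)" if q: "norm q < 1" for q
  proof -
    have q2: "norm (q\<^sup>2) < 1"
      using q by (simp add: norm_power abs_square_less_1)
    have "((\<lambda>n. 1 / 2 ^ c * f (q\<^sup>2) n) has_sum 1 / 2 ^ c * lambert c (q\<^sup>2)) {1..}"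
      unfolding f_def by (intro has_sum_cmult_right has_sum_lambert q2)
    also have "?this \<longleftrightarrow> (f q has_sum 1 / 2 ^ c * lambert c (q\<^sup>2)) {n. even n \<and> n \<noteq> 0}"
      by (rule has_sum_reindex_bij_witness[of _ "\<lambda>n. n div 2" "\<lambda>i. 2 * i"])
         (auto simp: f_def power_mult power_mult_distrib)
    finally have "(f q has_sum O' q + 1 / 2 ^ c * lambert c (q\<^sup>2)) ({n. odd n} \<union> {n. even n \<and> n \<noteq> 0})"
      by (intro has_sum_Un_disjoint odd q) auto
    also have "{n :: nat. odd n} \<union> {n. even n \<and> n \<noteq> 0} = {1..}"
      by (auto simp: Suc_le_eq odd_pos)
    finally show ?thesis
      using has_sum_lambert[OF q, of c] has_sum_unique unfolding f_def by blast
  qed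
  have q2: "norm (q\<^sup>2) < 1" and q': "norm (- q) < 1"
    using q by (simp_all add: norm_power abs_square_less_1)
  have "((\<lambda>n. f q n + f (- q) n) has_sum (O' q + O' (- q))) {n. odd n}"
    by (intro has_sum_add odd q q')
  also have "?this \<longleftrightarrow> ((\<lambda>n. 2 * f (q\<^sup>2) n) has_sum (O' q + O' (- q))) {n. odd n}"
  proof (rule has_sum_cong)
    fix n :: nat assume "n \<in> {n. odd n}"
    then have n: "odd n" by simp
    define w where "w = q ^ n"
    have w: "1 - w \<noteq> 0" "1 + w \<noteq> 0"
      using power_neq_1[OF q, of n] power_neq_1[OF q', of n] n
      by (auto simp: w_def odd_pos Suc_le_eq add_eq_0_iff)
    have "1 - w\<^sup>2 = (1 - w) * (1 + w)"
      by (simp add: power2_eq_square algebra_simps)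
    then have "w / (1 - w) + - w / (1 - (- w)) = 2 * (w\<^sup>2 / (1 - w\<^sup>2))"
      using w by (simp add: divide_simps) (simp add: algebra_simps power2_eq_square)
    moreover have "(- q) ^ n = - w" "(q\<^sup>2) ^ n = w\<^sup>2"
      using n by (simp_all add: w_def mult.commute flip: power_mult)
    ultimately show "f q n + f (- q) n = 2 * f (q\<^sup>2) n"
      unfolding f_def w_def[symmetric] by (simp only: distrib_left[symmetric]) simp
  qed
  finally have "O' q + O' (- q) = 2 * O' (q\<^sup>2)"
    using has_sum_cmult_right[OF odd[OF q2], of 2] has_sum_unique by blast
  then show ?thesis
    using split[OF q] split[OF q'] split[OF q2] by (simp add: algebra_simps add_divide_distrib flip: power_mult)
qed

section \<open>Conjugation symmetry and the passage to \<open>zeta\<close> and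
  \<open>lambert_series\<close>\<close>

lemma cnj_lambert: "cnj (lambert c q) = lambert c (cnj q)"
  unfolding lambert_def infsum_cnj[symmetric] by simp

lemma cnj_zeta_nat: "cnj (zeta_nat c) = zeta_nat c"
  unfolding zeta_nat_def infsum_cnj[symmetric] by simp

lemma zeta_of_nat:
  assumes "c \<ge> 2"
  shows "zeta (of_nat c) = zeta_nat c"
proof -
  have "(\<lambda>n. 1 / of_nat (Suc n) ^ c) sums zeta_nat c"
    by (intro has_sum_imp_sums_Suc has_sum_zeta_nat assms)
  then have "dirichlet_zeta (of_nat c) = zeta_nat c"
    unfolding dirichlet_zeta_def by (simp add: sums_iff powr_nat' del: of_nat_Suc)
  then show ?thesis
    using assms by (simp add: zeta_def)
qed

lemma lambert_series_of_nat:
  assumes "norm q < 1"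
  shows "lambert_series q (- of_nat c) = lambert c q"
proof -
  have "(\<lambda>n. 1 / of_nat (Suc n) ^ c * (q ^ Suc n / (1 - q ^ Suc n))) sums lambert c q"
    by (intro has_sum_imp_sums_Suc has_sum_lambert assms)
  then show ?thesis
    unfolding lambert_series_def
    by (simp add: sums_iff powr_minus powr_nat' divide_inverse mult.assoc del: of_nat_Suc power_Suc)
qed

text \<open>Terms \<open>j\<close> and \<open>2 * k - j\<close> are paired. The middle term is
  paired with itself and hence halved, which is the origin of the Kronecker delta in
  \<open>coeff_b\<close>.\<close>

lemma sum_atMost_double_reflect:
  fixes g :: "nat \<Rightarrow> real"
  shows "(\<Sum>j\<le>2 * k. g j) = (\<Sum>j\<le>k. (g j + g (2 * k - j)) / (1 + (if j = k then 1 else 0)))"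
proof -
  have "(\<Sum>j\<le>2 * k. g j) = (\<Sum>j\<in>{..k} \<union> {k<..2 * k}. g j)"
    by (intro sum.cong) auto
  also have "\<dots> = (\<Sum>j\<le>k. g j) + (\<Sum>j\<in>{k<..2 * k}. g j)"
    by (rule sum.union_disjoint) auto
  also have "(\<Sum>j\<in>{k<..2 * k}. g j) = (\<Sum>j<k. g (2 * k - j))"
    by (rule sum.reindex_bij_witness[of _ "\<lambda>j. 2 * k - j" "\<lambda>j. 2 * k - j"]) auto
  also have "(\<Sum>j\<le>k. g j) + (\<Sum>j<k. g (2 * k - j)) = (\<Sum>j<k. g j + g (2 * k - j)) + g k"
    by (simp add: sum.distrib flip: lessThan_Suc_atMost)
  also have "(\<Sum>j<k. g j + g (2 * k - j)) = (\<Sum>j<k. (g j + g (2 * k - j)) / (1 + (if j = k then 1 else 0)))"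
    by (intro sum.cong) auto
  finally show ?thesis
    by (simp flip: lessThan_Suc_atMost)
qed

text \<open>The arguments \<open>2 u\<close> and \<open>u + (2 j + 3) \<pi> / 2\<close>, where \<open>u = (4 k - 1 - 2 j) \<pi> / 6\<close>,
  add up to the odd multiple \<open>(2 k + 1) \<pi>\<close> of \<open>\<pi>\<close>.\<close>

lemma sin_third_eq_cos_sixth:
  "sin ((4 * real k - 1 - 2 * real j) * pi / 3) = (-1) ^ (j + 1) * cos ((4 * real k - 1 - 2 * real j) * pi / 6)"
proof -
  define u where "u = (4 * real k - 1 - 2 * real j) * pi / 6"
  define v where "v = u + pi / 2 + real (j + 1) * pi"
  have "sin (2 * u) = sin (pi - v + real (2 * k) * pi)"
    by (rule arg_cong[of _ _ sin]) (simp add: u_def v_def field_simps)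
  also have "\<dots> = sin (u + pi / 2 + real (j + 1) * pi)"
    unfolding v_def[symmetric] sin_add[of _ "real (2 * k) * pi"] cos_npi sin_npi by simp
  also have "\<dots> = (-1) ^ (j + 1) * cos u"
    unfolding sin_add[of _ "real (j + 1) * pi"] cos_npi sin_npi by (simp add: sin_add)
  also have "2 * u = (4 * real k - 1 - 2 * real j) * pi / 3"
    by (simp add: u_def)
  finally show ?thesis
    unfolding u_def .
qed

text \<open>Ramanujan's formula at t = 2 exp(i pi/3), divided by \<open>t ^ (2 * p)\<close>, in real
  parts. After the division the series at \<open>- 1 / t\<close> has a real coefficient, so its real
  part is half the sum over the conjugate points. The zeta value occurs on both sides, and
  collecting it produces \<open>coeff_a k\<close>.\<close>

lemma zeta_nat_at_twice_sixth_root: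
  fixes k :: nat
  assumes k: "k \<ge> 1"
  defines "x \<equiv> exp (- sqrt 3 * pi / 2)" and "c \<equiv> 4 * k - 1"
  defines "B \<equiv> \<lambda>j. bernoulli (2 * j) / fact (2 * j)"
  shows "of_real (coeff_a k) * zeta_nat c =
    of_real ((2 * pi) ^ c * (\<Sum>j\<le>2 * k. 2 ^ (2 * j + 1) * sin ((4 * real k - 1 - 2 * real j) * pi / 3) * (B j * B (2 * k - j))))
    - 2 ^ (4 * k) * (lambert c (\<i> * of_real x) + lambert c (- \<i> * of_real x))
    - 8 * of_real (cos ((2 * real k - 1) * pi / 3)) * lambert c (of_real x ^ 4)"
proof -
  define p where "p = 2 * k - 1"
  define t :: complex where "t = 2 * cis (pi / 3)"
  have c: "c = 2 * p + 1" and p: "p \<ge> 1" "odd p" "p + 1 = 2 * k"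
    using k by (auto simp: c_def p_def)
  have t_eq: "t = Complex 1 (sqrt 3)"
    by (simp add: t_def complex_eq_iff cos_60 sin_60)
  have t: "Im t > 0" "t \<noteq> 0"
    by (auto simp: t_eq complex_eq_iff)
  have inv: "- 1 / t = Complex (- 1 / 4) (sqrt 3 / 4)"
    using t(2) by (simp add: t_eq field_simps) (simp add: complex_eq_iff)
  \<comment> \<open>The real part 1 of \<open>t\<close> contributes a full period of the
    exponential.\<close>
  have x4: "of_real x ^ 4 = exp (2 * of_real pi * \<i> * t)"
  proof -
    have "2 * of_real pi * \<i> * t = of_real (- sqrt 3 * pi / 2 * 4) + 2 * of_real pi * \<i>"
      by (simp add: t_eq complex_eq_iff)
    then have "exp (2 * of_real pi * \<i> * t) = of_real (exp (- sqrt 3 * pi / 2 * 4))"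
      by (simp only: exp_add exp_two_pi_i exp_of_real) simp
    also have "exp (- sqrt 3 * pi / 2 * 4) = x ^ 4"
      by (simp add: x_def flip: exp_of_nat_mult)
    finally show ?thesis by simp
  qed
  \<comment> \<open>The real part -1/4 of \<open>- 1 / t\<close> contributes a quarter turn.\<close>
  have ix: "- \<i> * of_real x = exp (2 * of_real pi * \<i> * (- 1 / t))"
  proof -
    have "2 * of_real pi * \<i> * (- 1 / t) = of_real (- sqrt 3 * pi / 2) + - (of_real pi / 2 * \<i>)"
      unfolding inv by (simp add: complex_eq_iff)
    then have "exp (2 * of_real pi * \<i> * (- 1 / t)) = of_real x * exp (- (of_real pi / 2 * \<i>))"
      by (simp only: exp_add exp_of_real x_def)
    also have "exp (- (of_real pi / 2 * \<i>)) = - \<i>"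
      by (simp add: complex_eq_iff Re_exp Im_exp)
    finally show ?thesis by simp
  qed
  define L4 where "L4 = lambert c (of_real x ^ 4)"
  define L where "L = lambert c (- \<i> * of_real x)"
  define S where "S = (\<Sum>j\<le>2 * k. t ^ (2 * j) / t ^ c * of_real (B j * B (2 * k - j)))"
  have "zeta_nat c + 2 * L4 = t ^ (2 * p) * (zeta_nat c + 2 * L)
     - \<i> * (2 * of_real pi) ^ c / t * (\<Sum>j\<le>2 * k. t ^ (2 * j) * of_real (B j * B (2 * k - j)))"
    using ramanujan_formula[OF t(1) p(1) c] p(2) unfolding L4_def L_def x4 ix B_def p(3) by simp
  then have "(zeta_nat c + 2 * L4) / t ^ (2 * p) = (zeta_nat c + 2 * L) 
     - \<i> * (2 * of_real pi) ^ c / (t * t ^ (2 * p)) * (\<Sum>j\<le>2 * k. t ^ (2 * j) * of_real (B j * B (2 * k - j)))"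
    using t by (simp add: diff_divide_distrib)
  also have "\<i> * (2 * of_real pi) ^ c / (t * t ^ (2 * p)) * (\<Sum>j\<le>2 * k. t ^ (2 * j) * of_real (B j * B (2 * k - j)))
    = \<i> * (2 * of_real pi) ^ c * S"
    unfolding S_def sum_distrib_left by (simp add: c)
  finally have *: "(zeta_nat c + 2 * L4) / t ^ (2 * p) = zeta_nat c + 2 * L - \<i> * (2 * of_real pi) ^ c * S" .
  have real_zeta: "zeta_nat c = of_real (Re (zeta_nat c))"
    by (rule of_real_Re[symmetric]) (simp add: Reals_cnj_iff cnj_zeta_nat)
  have real_L4: "L4 = of_real (Re L4)"
    unfolding L4_def by (rule of_real_Re[symmetric]) (simp add: Reals_cnj_iff cnj_lambert)
  have L_add: "lambert c (\<i> * of_real x) + lambert c (- \<i> * of_real x) = of_real (2 * Re L)"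
  proof -
    have "lambert c (\<i> * of_real x) = cnj L"
      by (simp add: L_def cnj_lambert)
    then show ?thesis
      using complex_add_cnj[of L] unfolding L_def[symmetric] by (simp only: add.commute)
  qed
  have t_pow: "t ^ n = of_real (2 ^ n) * cis (real n * pi / 3)" for n
    by (simp only: t_def power_mult_distrib Complex.DeMoivre of_real_power of_real_numeral times_divide_eq_right)
  \<comment> \<open>The angles 2p pi/3 and p pi/3 add up to p pi, and \<open>p\<close> is
    odd.\<close>
  have cos_eq: "cos (real (2 * p) * pi / 3) = - cos ((2 * real k - 1) * pi / 3)"
  proof -
    have "cos (real (2 * p) * pi / 3) = cos (real p * pi - real p * pi / 3)"
      by (rule arg_cong[of _ _ cos]) (simp add: field_simps)
    also have "\<dots> = - cos (real p * pi / 3)"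
      unfolding cos_diff using p(2) by simp
    also have "real p = 2 * real k - 1"
      using k by (simp add: p_def of_nat_diff)
    finally show ?thesis .
  qed
  define C where "C = cos ((2 * real k - 1) * pi / 3)"
  have num: "zeta_nat c + 2 * L4 = of_real (Re (zeta_nat c) + 2 * Re L4)"
    by (simp only: of_real_add of_real_mult of_real_numeral real_zeta[symmetric] real_L4[symmetric])
  have div: "of_real X / (of_real Y * cis a) = complex_of_real (X / Y) * cis (- a)" for X Y a
    by (simp add: divide_inverse flip: cis_inverse)
  have "(zeta_nat c + 2 * L4) / t ^ (2 * p) =
      of_real ((Re (zeta_nat c) + 2 * Re L4) / 2 ^ (2 * p)) * cis (- (real (2 * p) * pi / 3))"
    unfolding t_pow num by (rule div)
  then have "Re ((zeta_nat c + 2 * L4) / t ^ (2 * p)) =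
      (Re (zeta_nat c) + 2 * Re L4) / 2 ^ (2 * p) * cos (real (2 * p) * pi / 3)"
    by simp
  then have e1: "Re ((zeta_nat c + 2 * L4) / t ^ (2 * p)) = - (Re (zeta_nat c) + 2 * Re L4) / 2 ^ (2 * p) * C"
    unfolding cos_eq C_def by (simp only: minus_divide_left[symmetric] mult_minus_left mult_minus_right)
  have "\<i> * (2 * of_real pi) ^ c * S = \<i> * (of_real ((2 * pi) ^ c) * S)"
    by simp
  then have e2: "Re (zeta_nat c + 2 * L - \<i> * (2 * of_real pi) ^ c * S) = Re (zeta_nat c) + 2 * Re L + (2 * pi) ^ c * Im S"
    by (simp del: of_real_power)
  have k_eq: "4 * k = c + 1" "4 * k = 2 * p + 2"
    using k by (simp_all add: c_def p_def)
  have pow: "(2 :: real) ^ (4 * k) = 2 * 2 ^ c" "(2 :: real) ^ (4 * k) = 4 * 2 ^ (2 * p)"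
    by (simp add: k_eq(1)) (simp add: k_eq(2))
  \<comment> \<open>The net exponent of \<open>t\<close> is \<open>2 * j - c\<close>, the negative
    of \<open>4 * k - 1 - 2 * j\<close>.\<close>
  have Im_t: "Im (t ^ (2 * j) / t ^ c) = - (2 ^ (2 * j + 1) * sin ((4 * real k - 1 - 2 * real j) * pi / 3)) / 2 ^ (4 * k)" for j
  proof -
    have "t ^ (2 * j) / t ^ c = of_real (2 ^ (2 * j) / 2 ^ c) * cis (real (2 * j) * pi / 3 - real c * pi / 3)"
      unfolding t_pow cis_divide[symmetric] by simp
    also have "real (2 * j) * pi / 3 - real c * pi / 3 = - ((4 * real k - 1 - 2 * real j) * pi / 3)"
      using k by (simp add: c_def of_nat_diff field_simps)
    finally show ?thesis
      unfolding pow(1) by simp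
  qed
  define R where "R = (\<Sum>j\<le>2 * k. 2 ^ (2 * j + 1) * sin ((4 * real k - 1 - 2 * real j) * pi / 3) * (B j * B (2 * k - j)))"
  have Im_scale: "Im (w * of_real r) = Im w * r" for w r
    by simp
  have e3: "Im S = - R / 2 ^ (4 * k)"
    unfolding S_def R_def Im_sum minus_divide_left[symmetric] sum_divide_distrib sum_negf[symmetric]
    by (intro sum.cong refl) (simp only: Im_scale Im_t, simp)
  have a: "coeff_a k = 2 ^ (4 * k) + 4 * C"
  proof -
    have "C = cos ((4 * real k + 1) * pi / 6 - pi / 2)"
      unfolding C_def
      by (rule arg_cong[of _ _ cos])
         (simp add: add_divide_distrib diff_divide_distrib left_diff_distrib distrib_right)
    then have "C = sin ((4 * real k + 1) * pi / 6)"
      by (simp only: cos_diff cos_pi_half sin_pi_half)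
    then show ?thesis
      unfolding coeff_a_def by (simp only:)
  qed
  \<comment> \<open>Multiplication of the real-part equation by \<open>4 * Q = 2 ^ (4 * k)\<close>,
    where \<open>Q\<close> stands for \<open>2 ^ (2 * p)\<close>, \<open>z\<close> for the zeta
    value and \<open>P\<close> for the power of 2 pi.\<close>
  have clear: "(4 * Q + 4 * C) * z = P * R - 4 * Q * (2 * l) - 8 * C * l4"
    if "Q \<noteq> 0" "- (z + 2 * l4) / Q * C = z + 2 * l + P * (- R / (4 * Q))" for Q C z P R l l4 :: real
  proof -
    have "4 * Q * (- (z + 2 * l4) / Q * C) = 4 * Q * (z + 2 * l + P * (- R / (4 * Q)))"
      using that(2) by simp
    moreover have "4 * Q * (- (z + 2 * l4) / Q * C) = - 4 * (z + 2 * l4) * C"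
      using that(1) by simp
    moreover have "4 * Q * (z + 2 * l + P * (- R / (4 * Q))) = 4 * Q * (z + 2 * l) - P * R"
      using that(1) by (simp add: field_simps)
    ultimately show ?thesis
      by algebra
  qed
  have "- (Re (zeta_nat c) + 2 * Re L4) / 2 ^ (2 * p) * C =
      Re (zeta_nat c) + 2 * Re L + (2 * pi) ^ c * (- R / 2 ^ (4 * k))"
    using * e1 e2 e3 by simp
  then have "coeff_a k * Re (zeta_nat c) = (2 * pi) ^ c * R - 2 ^ (4 * k) * (2 * Re L) - 8 * C * Re L4"
    unfolding a pow(2) using clear[of "2 ^ (2 * p)"] by simp
  then have "complex_of_real (coeff_a k * Re (zeta_nat c)) =
      of_real ((2 * pi) ^ c * R - 2 ^ (4 * k) * (2 * Re L) - 8 * C * Re L4)"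
    by (rule arg_cong)
  then have "of_real (coeff_a k) * of_real (Re (zeta_nat c)) =
      of_real ((2 * pi) ^ c * R) - 2 ^ (4 * k) * of_real (2 * Re L) - 8 * of_real C * complex_of_real (Re L4)"
    by (simp only: of_real_diff of_real_mult of_real_power of_real_numeral)
  then show ?thesis
    unfolding real_zeta[symmetric] real_L4[symmetric] L_add L4_def[symmetric] R_def[symmetric] C_def[symmetric] .
qed

theorem theorem5p1:
  fixes k :: nat
  assumes "k \<ge> 1"
  shows "zeta (4 * of_nat k - 1) =
    of_real ((2 * pi) ^ (4 * k - 1) *
      (\<Sum>j=0..k. (-1) ^ (j + 1) * coeff_b j k * bernoulli (2 * j) * bernoulli (4 * k - 2 * j)
                    / (fact (2 * j) * fact (4 * k - 2 * j))))
    + of_real ((2 ^ (4 * k + 1) + 4) / coeff_a k)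
        * lambert_series (of_real (exp (- sqrt 3 * pi))) (- 4 * of_nat k + 1)
    - of_real ((2 ^ (4 * k + 2) + 2 powi (- 4 * int k + 4) + 12
                 + 8 * cos ((2 * real k - 1) * pi / 3)) / coeff_a k)
        * lambert_series (of_real (exp (- 2 * sqrt 3 * pi))) (- 4 * of_nat k + 1)
    + of_real ((2 powi (- 4 * int k + 4) + 8) / coeff_a k)
        * lambert_series (of_real (exp (- 4 * sqrt 3 * pi))) (- 4 * of_nat k + 1)"
proof -
  define c where "c = 4 * k - 1"
  define x where "x = exp (- sqrt 3 * pi / 2)"
  define y :: complex where "y = of_real (exp (- sqrt 3 * pi))"
  define B where "B = (\<lambda>j. bernoulli (2 * j) / fact (2 * j))"
  define C where "C = cos ((2 * real k - 1) * pi / 3)"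
  define R where "R = (\<Sum>j=0..k. (-1) ^ (j + 1) * coeff_b j k * bernoulli (2 * j) * bernoulli (4 * k - 2 * j)
                    / (fact (2 * j) * fact (4 * k - 2 * j)))"
  have c: "c \<ge> 2" "4 * k = c + 1"
    using assms by (auto simp: c_def)
  have x: "norm (complex_of_real x) < 1" and y: "norm y < 1"
    by (auto simp: x_def y_def)
  have y2: "of_real (exp (- 2 * sqrt 3 * pi)) = y\<^sup>2" and y4: "of_real (exp (- 4 * sqrt 3 * pi)) = y ^ 4"
    and x2: "(of_real x)\<^sup>2 = y"
    by (simp_all add: x_def y_def flip: exp_of_nat_mult of_real_power)
  have x4: "of_real x ^ 4 = y\<^sup>2"
    unfolding x2[symmetric] by (simp flip: power_mult)
  have yn: "norm (y\<^sup>2) < 1" "norm (y ^ 4) < 1"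
    using y by (simp_all add: norm_power power_less_one_iff)
  \<comment> \<open>First duplication, at q = ix: its square is \<open>- y\<close> and its fourth
    power \<open>y\<^sup>2\<close>.\<close>
  have ix: "lambert c (\<i> * of_real x) + lambert c (- \<i> * of_real x) =
      2 * (1 + 1 / 2 ^ c) * lambert c (- y) - 2 / 2 ^ c * lambert c (y\<^sup>2)"
    using lambert_add_neg[of "\<i> * of_real x" c] x by (simp add: norm_mult power_mult_distrib x2 x4)
  \<comment> \<open>Second duplication, at \<open>y\<close>, solved for the series at
    \<open>- y\<close>.\<close>
  have neg_y: "lambert c (- y) = - lambert c y + 2 * (1 + 1 / 2 ^ c) * lambert c (y\<^sup>2) - 2 / 2 ^ c * lambert c (y ^ 4)"
    using lambert_add_neg[OF y, of c] by (simp add: algebra_simps)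
  \<comment> \<open>The power of 2 is at least 16 and the sine term at least -4, so division by
    \<open>coeff_a k\<close> is legitimate.\<close>
  have a: "coeff_a k > 0"
  proof -
    have "(2 :: real) ^ 4 \<le> 2 ^ (4 * k)"
      using assms by (intro power_increasing) auto
    then have "16 \<le> (2 :: real) ^ (4 * k)"
      by simp
    moreover have "-1 \<le> sin ((4 * real k + 1) * pi / 6)"
      by simp
    ultimately show ?thesis
      unfolding coeff_a_def by linarith
  qed
  \<comment> \<open>Folding the sum at \<open>k\<close> and turning sines into cosines yields
    \<open>coeff_b\<close>. The paired indices \<open>j\<close> and \<open>l = 2 * k - j\<close>
    have equal parity, so both terms carry the sign \<open>(-1) ^ (j + 1)\<close>.\<close>
  have sum: "(\<Sum>j\<le>2 * k. 2 ^ (2 * j + 1) * sin ((4 * real k - 1 - 2 * real j) * pi / 3) * (B j * B (2 * k - j))) = coeff_a k * R"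
    unfolding sum_atMost_double_reflect
    unfolding R_def sum_distrib_left atMost_atLeast0
  proof (rule sum.cong)
    fix j assume "j \<in> {0..k}"
    then have j: "j \<le> k" by simp
    define l where "l = 2 * k - j"
    have l: "2 * k - l = j" "real l = 2 * real k - real j" "2 * l = 4 * k - 2 * j"
      using j by (auto simp: l_def of_nat_diff)
    \<comment> \<open>The integer exponent is nonnegative for \<open>j\<close> up to
      \<open>k\<close>; it equals \<open>2 * l + 1\<close>.\<close>
    have pw: "2 powi (4 * int k + 1 - 2 * int j) = (2 :: real) ^ (2 * l + 1)"
    proof -
      have "4 * int k + 1 - 2 * int j = int (2 * l + 1)"
        using j by (simp add: l_def of_nat_diff)
      then show ?thesis
        by (simp only: power_int_of_nat)
    qed
    have "(-1 :: real) ^ (l + 1) = (-1) ^ (j + 1)"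
      using j by (intro minus_one_power_iff[THEN trans] sym[OF minus_one_power_iff[THEN trans]]) (auto simp: l_def)
    then have s: "sin ((4 * real k - 1 - 2 * real l) * pi / 3) = (-1) ^ (j + 1) * cos ((2 * real j - 1) * pi / 6)"
      unfolding sin_third_eq_cos_sixth by (simp add: l)
    have gen: "(U * (e * P) * (b * b') + V * (e * Q) * (b' * b)) / d = a * (e * ((V * Q + U * P) / (a * d)) * (b * b'))"
      if "a \<noteq> 0" for U V P Q e a b b' d :: real
      using that by (cases "d = 0") (simp_all add: field_simps)
    have "(2 ^ (2 * j + 1) * sin ((4 * real k - 1 - 2 * real j) * pi / 3) * (B j * B l) +
           2 ^ (2 * l + 1) * sin ((4 * real k - 1 - 2 * real l) * pi / 3) * (B l * B j)) / d =
        coeff_a k * ((-1) ^ (j + 1) * ((2 ^ (2 * l + 1) * cos ((2 * real j - 1) * pi / 6) +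
          2 ^ (2 * j + 1) * cos ((4 * real k - 1 - 2 * real j) * pi / 6)) / (coeff_a k * d)) * (B j * B l))" for d
      unfolding s sin_third_eq_cos_sixth[of k j] using a by (intro gen) simp
    note eq = this
    have rearrange: "e * X * b * b' / (f * f') = e * X * (b / f * (b' / f'))" for e X b b' f f' :: real
      by simp
    have B_eq: "bernoulli (2 * i) / fact (2 * i) = B i" for i
      by (simp add: B_def)
    from eq[of "1 + (if j = k then 1 else 0)"]
    show "(2 ^ (2 * j + 1) * sin ((4 * real k - 1 - 2 * real j) * pi / 3) * (B j * B (2 * k - j)) +
        2 ^ (2 * (2 * k - j) + 1) * sin ((4 * real k - 1 - 2 * real (2 * k - j)) * pi / 3) *
        (B (2 * k - j) * B (2 * k - (2 * k - j)))) / (1 + (if j = k then 1 else 0)) =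
      coeff_a k * ((-1) ^ (j + 1) * coeff_b j k * bernoulli (2 * j) * bernoulli (4 * k - 2 * j)
        / (fact (2 * j) * fact (4 * k - 2 * j)))"
      unfolding l_def[symmetric] l(1) coeff_b_def pw l(3)[symmetric] rearrange B_eq .
  qed simp
  have args: "4 * of_nat k - 1 = (of_nat c :: complex)" "- 4 * of_nat k + 1 = - (of_nat c :: complex)"
    using assms by (simp_all add: c_def of_nat_diff)
  have pows: "(2 :: real) ^ (4 * k) = 2 * 2 ^ c" "(2 :: real) ^ (4 * k + 1) = 4 * 2 ^ c" "(2 :: real) ^ (4 * k + 2) = 8 * 2 ^ c"
    unfolding c(2) by simp_all
  have powi_arg: "- 4 * int k + 4 = 3 - int c"
    using c(2) by simp
  have powi: "(2 :: real) powi (- 4 * int k + 4) = 8 / 2 ^ c"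
    unfolding powi_arg by (simp add: power_int_diff)
  have main: "of_real (coeff_a k) * zeta_nat c = of_real ((2 * pi) ^ c * (coeff_a k * R))
    - 2 ^ (4 * k) * (2 * (1 + 1 / 2 ^ c) * lambert c (- y) - 2 / 2 ^ c * lambert c (y\<^sup>2))
    - 8 * of_real C * lambert c (y\<^sup>2)"
    using zeta_nat_at_twice_sixth_root[OF assms] unfolding c_def[symmetric] x_def[symmetric] ix x4 C_def[symmetric] sum[unfolded B_def] .
  \<comment> \<open>Substitution of the second duplication into the first, with
    \<open>w = 2 ^ c\<close>. Naming \<open>1 / w\<close> leaves a polynomial identity modulo
    \<open>w * i = 1\<close>.\<close>
  have expand: "X - 2 * w * (2 * (1 + 1 / w) * (- l1 + 2 * (1 + 1 / w) * l2 - 2 / w * l4) - 2 / w * l2) - D * l2 =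
      X' + (4 * w + 4) * l1 - (8 * w + 8 / w + 12 + D) * l2 + (8 / w + 8) * l4"
    if "w \<noteq> 0" "X = X'" for X X' w D l1 l2 l4 :: complex
  proof -
    define i where "i = 1 / w"
    have i: "w * i = 1" "2 / w = 2 * i" "8 / w = 8 * i"
      using that by (simp_all add: i_def)
    show ?thesis
      unfolding i i_def[symmetric] that(2) using i(1) by algebra
  qed
  note main
  also have "(2 :: complex) ^ (4 * k) = 2 * 2 ^ c"
    unfolding c(2) by simp
  also have "of_real ((2 * pi) ^ c * (coeff_a k * R))
      - 2 * 2 ^ c * (2 * (1 + 1 / 2 ^ c) * lambert c (- y) - 2 / 2 ^ c * lambert c (y\<^sup>2)) - 8 * of_real C * lambert c (y\<^sup>2)
    = of_real (coeff_a k) * of_real ((2 * pi) ^ c * R) + (4 * 2 ^ c + 4) * lambert c y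
      - (8 * 2 ^ c + 8 / 2 ^ c + 12 + 8 * of_real C) * lambert c (y\<^sup>2) + (8 / 2 ^ c + 8) * lambert c (y ^ 4)"
    unfolding neg_y by (rule expand) simp_all
  finally have "zeta_nat c = (of_real (coeff_a k) * of_real ((2 * pi) ^ c * R) + (4 * 2 ^ c + 4) * lambert c y
      - (8 * 2 ^ c + 8 / 2 ^ c + 12 + 8 * of_real C) * lambert c (y\<^sup>2) + (8 / 2 ^ c + 8) * lambert c (y ^ 4)) / of_real (coeff_a k)"
    using a by (simp add: eq_divide_eq mult.commute)
  also have "\<dots> = of_real ((2 * pi) ^ c * R) + of_real ((4 * 2 ^ c + 4) / coeff_a k) * lambert c y
      - of_real ((8 * 2 ^ c + 8 / 2 ^ c + 12 + 8 * C) / coeff_a k) * lambert c (y\<^sup>2)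
      + of_real ((8 / 2 ^ c + 8) / coeff_a k) * lambert c (y ^ 4)"
    using a by (simp add: add_divide_distrib diff_divide_distrib ring_distribs)
  finally show ?thesis
    unfolding args zeta_of_nat[OF c(1)] y_def[symmetric] y2 y4 lambert_series_of_nat[OF y]
      lambert_series_of_nat[OF yn(1)] lambert_series_of_nat[OF yn(2)] powi pows
      C_def[symmetric] R_def[symmetric] c_def[symmetric] .
qed

end
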